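(* Let $G$ be a finite connected weighted graph and let $0=\lambda_1<\lambda_2\le\dots\le\lambda_n$ be the variational eigenvalues of the graph $1$-Laplacian $\Delta_1$ on $G$. If $\lambda_k$ has multiplicity $r$, that is, $\lambda_{k-1}<\lambda_k=\lambda_{k+1}=\dots=\lambda_{k+r-1}<\lambda_{k+r}$, then any eigenfunction of $\Delta_1$ associated to the eigenvalue $\lambda_k$ induces at most $k+r-1$ strong nodal domains and at most $k+r-1$ weak nodal domains.
   Context: Graph: $G$ is a finite, connected, undirected graph with vertex set $V$, $n=|V|$, edge set $E$, strictly positive vertex weights $\mu(u)>0$ ($u\in V$) and symmetric edge weights $w(uv)=w(vu)$, with $w(uv)>0$ if $uv\in E$ and $w(uv)=0$ if $uv\notin E$. Eigenpairs of $\Delta_1$: let $\mathrm{Sign}(x)=\{1\}$ if $x>0$, $\{-1\}$ if $x<0$, and $[-1,1]$ if $x=0$. A nonzero $f:V\to\mathbb{R}$ is an eigenfunction of $\Delta_1$ with eigenvalue $\lambda$ if there are numbers $z(uv)$, $u,v\in V$, with $z(uv)=-z(vu)$ and $z(uv)\in\mathrm{Sign}(f(u)-f(v))$, such that $\sum_{v\in V}w(uv)z(uv)\in\lambda\,\mu(u)\,\mathrm{Sign}(f(u))$ for all $u\in V$. Variational eigenvalues: for nonzero $f:V\to\mathbb R$ let $\mathcal{R}_1(f)=\frac12\,\frac{\sum_{u,v\in V}w(uv)|f(u)-f(v)|}{\sum_{u\in V}\mu(u)|f(u)|}$, and let $\mathcal{S}_1=\{g:V\to\mathbb{R}:\sum_{u}\mu(u)|g(u)|=1\}$.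 For a closed symmetric set $A=-A\subseteq\mathcal{S}_1$ the Krasnoselskii genus $\gamma(A)$ is $0$ if $A=\emptyset$, and otherwise the smallest integer $m$ for which there is a continuous odd map $h:A\to\mathbb{R}^m\setminus\{0\}$ ($\infty$ if there is none). Let $\mathcal{F}_k(\mathcal{S}_1)=\{A\subseteq\mathcal{S}_1: A=-A,\ A\text{ closed},\ \gamma(A)\ge k\}$. The variational eigenvalues are $\lambda_k=\min_{A\in\mathcal{F}_k(\mathcal{S}_1)}\max_{f\in A}\mathcal{R}_1(f)$, $k=1,\dots,n$. In the definition of multiplicity, the inequality $\lambda_{k-1}<\lambda_k$ is void when $k=1$ and $\lambda_{k+r-1}<\lambda_{k+r}$ is void when $k+r-1=n$. Nodal domains: a subset $A\subseteq V$ is a strong (respectively weak) nodal domain induced by $f:V\to\mathbb R$ if the subgraph induced by $A$ is a maximal connected component of (the subgraph induced by) either $\{u:f(u)>0\}$ or $\{u:f(u)<0\}$ (respectively either $\{u:f(u)\ge 0\}$ or $\{u:f(u)\le 0\}$). *)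

theory Defs
  imports "HOL-Analysis.Analysis"
begin

text \<open>
  The vertex set is the whole of a finite type \<open>'v\<close>, so functions \<open>V \<rightarrow> \<real>\<close> are vectors
  \<open>f :: real^'v\<close> and \<open>n = CARD('v)\<close>.  Edges are unordered pairs \<open>{u, v}\<close>; loops \<open>{u, u} = {u}\<close>
  are not excluded (they contribute nothing to the 1-Laplacian or to \<open>\<R>\<^sub>1\<close>), so simple graphs
  are a special case.
\<close>

definition connected_subset :: "'v set set \<Rightarrow> 'v set \<Rightarrow> bool" where
  "connected_subset E A \<longleftrightarrow>
     A \<noteq> {} \<and> (\<forall>u\<in>A. \<forall>v\<in>A. (u, v) \<in> {(x, y). x \<in> A \<and> y \<in> A \<and> {x, y} \<in> E}\<^sup>*)"

definition connected_component_in :: "'v set set \<Rightarrow> 'v set \<Rightarrow> 'v set \<Rightarrow> bool" where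
  "connected_component_in E S A \<longleftrightarrow>
     A \<subseteq> S \<and> connected_subset E A \<and>
     (\<forall>B. A \<subseteq> B \<and> B \<subseteq> S \<and> connected_subset E B \<longrightarrow> B = A)"

locale connected_weighted_graph =
  fixes E :: "'v::finite set set" and w :: "'v \<Rightarrow> 'v \<Rightarrow> real" and \<mu> :: "'v \<Rightarrow> real"
  assumes edges: "e \<in> E \<Longrightarrow> \<exists>u v. e = {u, v}"
    and connected: "connected_subset E UNIV"
    and vertex_weight_pos: "\<mu> u > 0"
    and weight_sym: "w u v = w v u"
    and weight_pos: "{u, v} \<in> E \<Longrightarrow> w u v > 0"
    and weight_zero: "{u, v} \<notin> E \<Longrightarrow> w u v = 0"

definition Sign :: "real \<Rightarrow> real set" where
  "Sign x = (if x > 0 then {1} else if x < 0 then {-1} else {-1..1})"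

definition eigenpair1 ::
  "('v::finite \<Rightarrow> 'v \<Rightarrow> real) \<Rightarrow> ('v \<Rightarrow> real) \<Rightarrow> real^'v \<Rightarrow> real \<Rightarrow> bool" where
  "eigenpair1 w \<mu> f l \<longleftrightarrow> f \<noteq> 0 \<and>
     (\<exists>z :: 'v \<Rightarrow> 'v \<Rightarrow> real.
        (\<forall>u v. z u v = - z v u) \<and>
        (\<forall>u v. z u v \<in> Sign (f $ u - f $ v)) \<and>
        (\<forall>u. (\<Sum>v\<in>UNIV. w u v * z u v) \<in> (\<lambda>s. l * \<mu> u * s) ` Sign (f $ u)))"

definition rayleigh1 ::
  "('v::finite \<Rightarrow> 'v \<Rightarrow> real) \<Rightarrow> ('v \<Rightarrow> real) \<Rightarrow> real^'v \<Rightarrow> real" where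
  "rayleigh1 w \<mu> f =
     1 / 2 * ((\<Sum>u\<in>UNIV. \<Sum>v\<in>UNIV. w u v * \<bar>f $ u - f $ v\<bar>) / (\<Sum>u\<in>UNIV. \<mu> u * \<bar>f $ u\<bar>))"

definition sphere1 :: "('v::finite \<Rightarrow> real) \<Rightarrow> (real^'v) set" where
  "sphere1 \<mu> = {g. (\<Sum>u\<in>UNIV. \<mu> u * \<bar>g $ u\<bar>) = 1}"

text \<open>
  Here \<open>\<real>\<^sup>m\<close> is the library topology \<open>Euclidean_space m\<close>, whose points are the
  \<open>x :: nat \<Rightarrow> real\<close> with \<open>x i = 0\<close> for all \<open>i \<ge> m\<close>.  The infimum of the empty set in \<open>enat\<close>
  is \<open>\<infinity>\<close>.
\<close>

definition odd_map_to_punctured :: "nat \<Rightarrow> 'a::real_normed_vector set \<Rightarrow> ('a \<Rightarrow> nat \<Rightarrow> real) \<Rightarrow> bool" where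
  "odd_map_to_punctured m A h \<longleftrightarrow>
     continuous_map (top_of_set A) (subtopology (Euclidean_space m) (- {\<lambda>i. 0})) h \<and>
     (\<forall>x\<in>A. h (- x) = (\<lambda>i. - h x i))"

definition genus :: "'a::real_normed_vector set \<Rightarrow> enat" where
  "genus A = (if A = {} then 0 else Inf {enat m |m. \<exists>h. odd_map_to_punctured m A h})"

definition genus_family :: "('v::finite \<Rightarrow> real) \<Rightarrow> nat \<Rightarrow> (real^'v) set set" where
  "genus_family \<mu> k = {A. A \<subseteq> sphere1 \<mu> \<and> uminus ` A = A \<and> closed A \<and> enat k \<le> genus A}"

text \<open>
  For \<open>1 \<le> k \<le> CARD('v)\<close> both extrema below are attained: every \<open>A\<close> in the family is a nonempty
  compact set on which the Rayleigh quotient is continuous, and the family is nonempty and stable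
  under Hausdorff limits.  So \<open>INF\<close> and \<open>SUP\<close> are the min and max of the usual definition.
  Only these values of \<open>k\<close> are meaningful.
\<close>

definition variational_eigenvalue ::
  "('v::finite \<Rightarrow> 'v \<Rightarrow> real) \<Rightarrow> ('v \<Rightarrow> real) \<Rightarrow> nat \<Rightarrow> real" where
  "variational_eigenvalue w \<mu> k = (INF A\<in>genus_family \<mu> k. SUP f\<in>A. rayleigh1 w \<mu> f)"

definition strong_nodal_domains :: "'v::finite set set \<Rightarrow> real^'v \<Rightarrow> 'v set set" where
  "strong_nodal_domains E f =
     {A. connected_component_in E {u. f $ u > 0} A \<or> connected_component_in E {u. f $ u < 0} A}"

definition weak_nodal_domains :: "'v::finite set set \<Rightarrow> real^'v \<Rightarrow> 'v set set" where
  "weak_nodal_domains E f =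
     {A. connected_component_in E {u. f $ u \<ge> 0} A \<or> connected_component_in E {u. f $ u \<le> 0} A}"

end

theory Submission
  imports Defs "HOL-Homology.Invariance_of_Domain"
begin


text \<open>
  Call a vertex set \<open>A\<close> cheap if the total weight of the edges leaving it is at most
  \<open>\<lambda>\<close> times its vertex weight.  The whole argument compares cheap sets with the variational
  eigenvalues.
  
  Cheap sets bound eigenvalues from above.  Let \<open>D\<close> be a family of pairwise disjoint nonempty
  cheap sets.  A combination \<open>g = \<Sum> c\<^sub>A 1\<^sub>A\<close> of their indicators has total variation at most
  \<open>\<Sum> \<bar>c\<^sub>A\<bar>\<close> times the boundary weights, whereas its weighted \<open>1\<close>-norm is exactly
  \<open>\<Sum> \<bar>c\<^sub>A\<bar>\<close> times the vertex weights, because the sets are disjoint; hence its Rayleigh quotient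
  is at most \<open>\<lambda>\<close> (\<open>rayleigh1_span_indicator_le\<close>).  The indicators span a space of dimension
  \<open>card D\<close>, and by the Borsuk-Ulam theorem (\<open>Borsuk_Ulam_subspace\<close>) its unit sphere has genus
  at least \<open>card D\<close>.  So the variational eigenvalue with index \<open>j\<close> is at most \<open>\<lambda>\<close>
  whenever \<open>1 \<le> j \<le> card D\<close> (\<open>variational_eigenvalue_le_disjoint_family\<close>).
  
  Nodal domains are cheap.  If \<open>A\<close> is a positive strong nodal domain of an eigenfunction \<open>f\<close>,
  then \<open>f\<close> strictly decreases along each edge leaving \<open>A\<close>, so the number \<open>z\<close> is \<open>1\<close> on
  those edges, while inside \<open>A\<close> it cancels by antisymmetry.  Summing the eigenvalue equation
  over \<open>A\<close> shows that \<open>A\<close> is cheap (\<open>boundary_weight_le\<close>).  The same sum works for a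
  weak nodal domain on which \<open>f\<close> vanishes identically: such domains do occur for the
  \<open>1\<close>-Laplacian, and the value \<open>f = 0\<close> turns the equation into the desired inequality.
  
  Let \<open>D\<close> consist of the strong nodal domains and of the weak ones on which \<open>f\<close> vanishes.
  These sets are pairwise disjoint, and every weak nodal domain contains a member of \<open>D\<close> which
  determines it, so \<open>card D\<close> bounds both numbers in the theorem.  If \<open>card D \<ge> k + r\<close>, the
  eigenvalue with index \<open>k + r\<close> would not exceed the one with index \<open>k\<close>, against the gap
  above \<open>k + r - 1\<close>.  If \<open>k + r - 1\<close> is the number of vertices, disjointness suffices.
  
  The Borsuk-Ulam theorem is derived from Borsuk's degree step: for an odd self-map of \<open>S\<^sup>n\<close>
  which maps the equator \<open>S\<^sup>n\<^sup>-\<^sup>1\<close> to itself, the degrees of the map and of its restriction to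
  the equator have the same parity.  A general odd map is first brought into this position by a
  homotopy through odd maps; by induction every odd self-map of a sphere has odd degree.  A map
  into a lower-dimensional sphere would have degree \<open>0\<close>.
\<close>

section \<open>Homotopies of sphere maps along segments\<close>

lemma nsphere_eq_top_of_set:
  "nsphere n = top_of_set {x. (\<Sum>i\<le>n. (x i)\<^sup>2) = 1 \<and> (\<forall>i>n. x i = 0)}"
  by (simp add: nsphere euclidean_product_topology)

lemma continuous_map_nsphere_iff:
  "continuous_map (nsphere m) (nsphere n) f \<longleftrightarrow>
     continuous_on (topspace (nsphere m)) f \<and> f \<in> topspace (nsphere m) \<rightarrow> topspace (nsphere n)"
  by (simp add: nsphere_eq_top_of_set)

lemma topspace_nsphere_iff:
  "x \<in> topspace (nsphere n) \<longleftrightarrow> (\<Sum>i\<le>n. (x i)\<^sup>2) = 1 \<and> (\<forall>i>n. x i = 0)"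
  by (simp add: nsphere)

text \<open>
  Radial projection of the punctured \<open>\<real>\<^sup>n\<^sup>+\<^sup>1\<close> onto \<open>S\<^sup>n\<close>, where the points of
  \<open>\<real>\<^sup>n\<^sup>+\<^sup>1\<close> are the sequences supported on \<open>{..n}\<close>.
\<close>

definition radial :: "nat \<Rightarrow> (nat \<Rightarrow> real) \<Rightarrow> nat \<Rightarrow> real" where
  "radial n x = (\<lambda>i. x i / sqrt (\<Sum>j\<le>n. (x j)\<^sup>2))"

lemma sum_squares_pos:
  fixes x :: "nat \<Rightarrow> real"
  assumes "\<exists>i\<le>n. x i \<noteq> 0"
  shows "(\<Sum>j\<le>n. (x j)\<^sup>2) > 0"
proof -
  obtain i where "i \<le> n" "x i \<noteq> 0" using assms by blast
  then show ?thesis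
    by (intro sum_pos2[of _ i]) auto
qed

lemma radial_in_nsphere:
  assumes "\<exists>i\<le>n. x i \<noteq> 0" "\<forall>i>n. x i = 0"
  shows "radial n x \<in> topspace (nsphere n)"
  using sum_squares_pos[OF assms(1)] assms(2)
  by (simp add: topspace_nsphere_iff radial_def power_divide flip: sum_divide_distrib)

lemma radial_nsphere_id:
  "x \<in> topspace (nsphere n) \<Longrightarrow> radial n x = x"
  by (simp add: topspace_nsphere_iff radial_def)

lemma radial_minus: "radial n (\<lambda>i. - x i) = (\<lambda>i. - radial n x i)"
  by (simp add: radial_def)

lemma continuous_on_radial:
  assumes "continuous_on S f" "\<And>x. x \<in> S \<Longrightarrow> \<exists>i\<le>n. f x i \<noteq> 0"
  shows "continuous_on S (\<lambda>x. radial n (f x))"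
  unfolding radial_def
proof (rule continuous_on_coordinatewise_then_product)
  fix i
  have c: "continuous_on S (\<lambda>x. f x j)" for j
    using assms(1) by (rule continuous_on_product_then_coordinatewise)
  have "sqrt (\<Sum>j\<le>n. (f x j)\<^sup>2) \<noteq> 0" if "x \<in> S" for x
    using sum_squares_pos[OF assms(2)[OF that]] by simp
  then show "continuous_on S (\<lambda>x. f x i / sqrt (\<Sum>j\<le>n. (f x j)\<^sup>2))"
    by (intro continuous_intros c) auto
qed

text \<open>
  The straight-line homotopy avoids the origin and can be projected to the sphere.  Both
  deformations in the degree theorem below have this form.
\<close>

lemma Brouwer_degree2_segment_homotopy:
  assumes f: "continuous_on (topspace (nsphere n)) f"
    and f0: "\<And>x i. x \<in> topspace (nsphere n) \<Longrightarrow> i > n \<Longrightarrow> f x i = 0"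
    and g: "continuous_on (topspace (nsphere n)) g"
    and g0: "\<And>x i. x \<in> topspace (nsphere n) \<Longrightarrow> i > n \<Longrightarrow> g x i = 0"
    and nz: "\<And>x t. x \<in> topspace (nsphere n) \<Longrightarrow> 0 \<le> t \<Longrightarrow> t \<le> 1 \<Longrightarrow>
               \<exists>i\<le>n. (1 - t) * f x i + t * g x i \<noteq> 0"
  shows "Brouwer_degree2 n (\<lambda>x. radial n (f x)) = Brouwer_degree2 n (\<lambda>x. radial n (g x))"
proof (rule Brouwer_degree2_homotopic)
  let ?S = "topspace (nsphere n)"
  let ?H = "\<lambda>y::real \<times> (nat \<Rightarrow> real). (\<lambda>i. (1 - fst y) * f (snd y) i + fst y * g (snd y) i)"
  have S: "nsphere n = top_of_set ?S"
    by (simp add: nsphere_eq_top_of_set)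
  have c: "continuous_on ({0..1} \<times> ?S) (\<lambda>y. f (snd y) i)" "continuous_on ({0..1} \<times> ?S) (\<lambda>y. g (snd y) i)" for i
    by (rule continuous_on_compose2[OF continuous_on_product_then_coordinatewise[OF f]
          continuous_on_snd[OF continuous_on_id]], force)
       (rule continuous_on_compose2[OF continuous_on_product_then_coordinatewise[OF g]
          continuous_on_snd[OF continuous_on_id]], force)
  have "continuous_on ({0..1} \<times> ?S) ?H"
    by (intro continuous_on_coordinatewise_then_product continuous_intros c)
  then have "continuous_on ({0..1} \<times> ?S) (\<lambda>y. radial n (?H y))"
    by (rule continuous_on_radial) (use nz in auto)
  moreover have "(\<lambda>y. radial n (?H y)) \<in> {0..1} \<times> ?S \<rightarrow> ?S"
    using nz f0 g0 by (auto intro!: radial_in_nsphere)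
  ultimately have "continuous_map (prod_topology (top_of_set {0..1}) (nsphere n)) (nsphere n) (\<lambda>y. radial n (?H y))"
    by (subst (1 2) S) simp
  then show "homotopic_with (\<lambda>x. True) (nsphere n) (nsphere n) (\<lambda>x. radial n (f x)) (\<lambda>x. radial n (g x))"
    unfolding homotopic_with_def
    by (intro exI[of _ "\<lambda>y. radial n (?H y)"]) auto
qed

lemma Brouwer_degree2_nonsurjective:
  assumes "continuous_map (nsphere n) (nsphere n) f" "f ` topspace (nsphere n) \<noteq> topspace (nsphere n)"
  shows "Brouwer_degree2 n f = 0"
  using nullhomotopic_nonsurjective_sphere_map[OF assms] Brouwer_degree2_nullhomotopic by metis

section \<open>Odd maps of spheres have odd degree\<close>

text \<open>
  The sphere \<open>S\<^sup>0\<close> has two points, so an odd self-map is the identity or the reflection.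
\<close>

lemma odd_degree_nsphere_0:
  assumes g: "continuous_map (nsphere 0) (nsphere 0) g"
    and odd: "\<And>x. x \<in> topspace (nsphere 0) \<Longrightarrow> g (\<lambda>i. - x i) = (\<lambda>i. - g x i)"
  shows "odd (Brouwer_degree2 0 g)"
proof -
  let ?S = "topspace (nsphere 0)"
  define e :: "nat \<Rightarrow> real" where "e = (\<lambda>i. if i = 0 then 1 else 0)"
  have S: "?S = {e, \<lambda>i. - e i}"
    by (auto simp: topspace_nsphere_iff e_def fun_eq_iff power2_eq_1_iff; metis gr0I)
  have ge: "g e \<in> {e, \<lambda>i. - e i}"
    using continuous_map_funspace[OF g] unfolding S by blast
  have gme: "g (\<lambda>i. - e i) = (\<lambda>i. - g e i)" using odd[of e] S by auto
  show ?thesis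
  proof (cases "g e = e")
    case True
    then have "Brouwer_degree2 0 g = Brouwer_degree2 0 id"
      by (intro Brouwer_degree2_eq) (use S gme in auto)
    then show ?thesis by simp
  next
    case False
    then have "g e = (\<lambda>i. - e i)" using ge by auto
    then have "g x = (\<lambda>i. if i = 0 then - x i else x i)" if "x = e \<or> x = (\<lambda>i. - e i)" for x
      using that by (elim disjE; simp add: gme; auto simp: e_def)
    then have "Brouwer_degree2 0 g = Brouwer_degree2 0 (\<lambda>x i. if i = 0 then - x i else x i)"
      by (intro Brouwer_degree2_eq) (use S in blast)
    then show ?thesis by (simp add: Brouwer_degree2_reflection)
  qed
qed


lemma euclidean_basis_enumeration:
  obtains b :: "nat \<Rightarrow> 'a::euclidean_space"
  where "bij_betw b {..<DIM('a)} Basis"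
    and "\<And>i j. i < DIM('a) \<Longrightarrow> j < DIM('a) \<Longrightarrow> b i \<bullet> b j = (if i = j then 1 else 0)"
proof -
  obtain b :: "nat \<Rightarrow> 'a" where b: "bij_betw b {..<DIM('a)} Basis"
    using ex_bij_betw_nat_finite[OF finite_Basis] by (metis atLeast0LessThan)
  have "b i \<bullet> b j = (if i = j then 1 else 0)" if "i < DIM('a)" "j < DIM('a)" for i j
  proof -
    have "b i \<in> Basis" "b j \<in> Basis" using b that by (auto simp: bij_betw_def)
    moreover have "b i = b j \<longleftrightarrow> i = j"
      using b that by (auto simp: bij_betw_def inj_on_def)
    ultimately show ?thesis by (simp add: inner_Basis)
  qed
  with b that show ?thesis by blast
qed

text \<open>
  General position for odd maps.  By the Weierstrass theorem \<open>g\<close> has a close polynomial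
  approximation \<open>p\<close>, which may be made odd.  The cone over the image of the equator is a smooth
  image of an \<open>n\<close>-dimensional set in \<open>\<real>\<^sup>n\<^sup>+\<^sup>1\<close>, hence negligible, and so it misses some vector
  \<open>a\<close> of the open upper half space; by oddness it misses the whole line through \<open>a\<close>.
  
  Polynomials and negligible sets live in a Euclidean space given by a type, whereas \<open>n\<close> must vary
  in the later induction.  So the sphere is placed in a fixed space \<open>'a\<close> of sufficiently large
  dimension, as the unit sphere of the span of the first \<open>n + 1\<close> basis vectors.
\<close>

lemma odd_map_near_avoiding_line:
  fixes g :: "(nat \<Rightarrow> real) \<Rightarrow> nat \<Rightarrow> real"
  assumes n: "n < DIM('a::euclidean_space)"
    and g: "continuous_map (nsphere n) (nsphere n) g"
    and odd: "\<And>x. x \<in> topspace (nsphere n) \<Longrightarrow> g (\<lambda>i. - x i) = (\<lambda>i. - g x i)"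
  obtains p a where "continuous_on (topspace (nsphere n)) p"
    and "\<And>x i. i > n \<Longrightarrow> p x i = 0"
    and "\<And>x. p (\<lambda>i. - x i) = (\<lambda>i. - p x i)"
    and "\<And>x. x \<in> topspace (nsphere n) \<Longrightarrow> (\<Sum>i\<le>n. (p x i - g x i)\<^sup>2) < 1"
    and "a n > 0" and "\<And>i. i > n \<Longrightarrow> a i = 0"
    and "\<And>x s. x \<in> topspace (nsphere n) \<Longrightarrow> x n = 0 \<Longrightarrow> \<exists>i\<le>n. p x i \<noteq> s * a i"
proof -
  let ?T = "topspace (nsphere n)"
  obtain b :: "nat \<Rightarrow> 'a" where b: "bij_betw b {..<DIM('a)} Basis"
    and bb: "\<And>i j. i < DIM('a) \<Longrightarrow> j < DIM('a) \<Longrightarrow> b i \<bullet> b j = (if i = j then 1 else 0)"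
    using euclidean_basis_enumeration by blast
  \<comment> \<open>\<open>\<iota>\<close> embeds \<open>\<real>\<^sup>n\<^sup>+\<^sup>1\<close> into \<open>'a\<close>,
    \<open>\<kappa>\<close> reads off coordinates, \<open>\<pi>\<close> is the orthogonal projection on the image of \<open>\<iota>\<close>\<close>
  define \<iota> where "\<iota> y = (\<Sum>i\<le>n. y i *\<^sub>R b i)" for y :: "nat \<Rightarrow> real"
  define \<kappa> where "\<kappa> v = (\<lambda>i. if i \<le> n then v \<bullet> b i else 0)" for v :: 'a
  define \<pi> where "\<pi> v = \<iota> (\<kappa> v)" for v :: 'a
  have \<iota>_inner: "\<iota> y \<bullet> b j = (if j \<le> n then y j else 0)" if "j < DIM('a)" for y j
  proof -
    have "\<iota> y \<bullet> b j = (\<Sum>i\<le>n. if i = j then y i else 0)"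
      unfolding \<iota>_def inner_sum_left by (intro sum.cong) (use n that in \<open>auto simp: bb\<close>)
    then show ?thesis by simp
  qed
  have \<iota>_norm: "(norm (\<iota> y))\<^sup>2 = (\<Sum>i\<le>n. (y i)\<^sup>2)" for y
  proof -
    have "(norm (\<iota> y))\<^sup>2 = (\<Sum>i\<le>n. y i * (\<iota> y \<bullet> b i))"
      unfolding power2_norm_eq_inner by (subst (2) \<iota>_def) (simp add: inner_sum_right)
    also have "\<dots> = (\<Sum>i\<le>n. (y i)\<^sup>2)"
      by (intro sum.cong) (use n in \<open>auto simp: \<iota>_inner power2_eq_square\<close>)
    finally show ?thesis .
  qed
  have \<kappa>_\<iota>: "\<kappa> (\<iota> y) = y" if "\<forall>i>n. y i = 0" for y
    using that n by (auto simp: \<kappa>_def \<iota>_inner fun_eq_iff)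
  have \<iota>_scale: "\<iota> (\<lambda>i. c * y i) = c *\<^sub>R \<iota> y" for c y
    by (simp add: \<iota>_def scaleR_sum_right)
  have \<iota>_minus: "\<iota> (\<lambda>i. - y i) = - \<iota> y" for y
    by (simp add: \<iota>_def sum_negf)
  have \<iota>_cong: "\<iota> y = \<iota> y'" if "\<And>i. i \<le> n \<Longrightarrow> y i = y' i" for y y'
    using that by (simp add: \<iota>_def)
  have \<pi>_eq: "\<pi> v = (\<Sum>i\<le>n. (v \<bullet> b i) *\<^sub>R b i)" for v
    by (simp add: \<pi>_def \<iota>_def \<kappa>_def)
  have \<pi>_linear: "linear \<pi>"
    unfolding \<pi>_eq by (intro linearI) (simp_all add: algebra_simps inner_add_left sum.distrib scaleR_sum_right)
  have bessel: "(\<Sum>i\<le>n. (v \<bullet> b i)\<^sup>2) \<le> (norm v)\<^sup>2" for v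
  proof -
    have "(\<Sum>i\<le>n. (v \<bullet> b i)\<^sup>2) \<le> (\<Sum>i<DIM('a). (v \<bullet> b i)\<^sup>2)"
      using n by (intro sum_mono2) auto
    also have "\<dots> = (\<Sum>u\<in>Basis. (v \<bullet> u)\<^sup>2)"
      using sum.reindex_bij_betw[OF b, of "\<lambda>u. (v \<bullet> u)\<^sup>2"] by simp
    also have "\<dots> = (norm v)\<^sup>2"
      unfolding power2_norm_eq_inner by (subst (2) euclidean_inner) (simp add: power2_eq_square)
    finally show ?thesis .
  qed
  define S where "S = {v. norm v = 1 \<and> \<pi> v = v}"
  have \<iota>_S: "\<iota> y \<in> S" if "y \<in> ?T" for y
  proof -
    have "(norm (\<iota> y))\<^sup>2 = 1" using that by (simp add: \<iota>_norm topspace_nsphere_iff)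
    then have "norm (\<iota> y) = 1" by (simp add: power2_eq_1_iff) (smt (verit) norm_ge_zero)
    moreover have "\<pi> (\<iota> y) = \<iota> y" using that by (simp add: \<pi>_def \<kappa>_\<iota> topspace_nsphere_iff)
    ultimately show ?thesis by (simp add: S_def)
  qed
  have \<kappa>_T: "\<kappa> v \<in> ?T" if "v \<in> S" for v
    using that \<iota>_norm[of "\<kappa> v"] by (auto simp: S_def topspace_nsphere_iff \<pi>_def) (simp add: \<kappa>_def)
  have \<pi>_cont: "continuous_on A \<pi>" for A
    using \<pi>_linear linear_continuous_on linear_conv_bounded_linear by blast
  have "closed {v. \<pi> v = v}"
    by (intro closed_Collect_eq \<pi>_cont continuous_on_id)
  moreover have "S = sphere 0 1 \<inter> {v. \<pi> v = v}" by (auto simp: S_def)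
  ultimately have "compact S" by (simp add: compact_Int_closed)
  moreover have "continuous_on S (\<lambda>v. \<iota> (g (\<kappa> v)))"
  proof -
    have "continuous_on S (\<lambda>v. \<kappa> v i)" for i
      unfolding \<kappa>_def by (cases "i \<le> n") (auto intro!: continuous_intros)
    then have "continuous_on S \<kappa>"
      by (rule continuous_on_coordinatewise_then_product)
    then have "continuous_on S (\<lambda>v. g (\<kappa> v))"
      by (rule continuous_on_compose2[of ?T g, rotated])
        (use g \<kappa>_T in \<open>auto simp: continuous_map_nsphere_iff\<close>)
    then show ?thesis
      unfolding \<iota>_def
      by (intro continuous_on_sum continuous_on_scaleR continuous_on_const)
        (rule continuous_on_product_then_coordinatewise)
  qed
  ultimately obtain P :: "'a \<Rightarrow> 'a" where P: "polynomial_function P"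
    and Pg: "\<And>v. v \<in> S \<Longrightarrow> norm (\<iota> (g (\<kappa> v)) - P v) < 1"
    using Stone_Weierstrass_polynomial_function[of S _ 1] by (metis zero_less_one)
  \<comment> \<open>the odd part of the approximation \<open>P\<close> is as close to the odd map \<open>g\<close> as \<open>P\<close> itself\<close>
  define R where "R v = (1/2) *\<^sub>R (P v - P (- v))" for v
  define p where "p y = \<kappa> (R (\<iota> y))" for y
  have R_minus: "R (- v) = - R v" for v by (simp add: R_def scaleR_diff_right)
  have p_minus: "p (\<lambda>i. - y i) = (\<lambda>i. - p y i)" for y
    by (auto simp: p_def \<iota>_minus R_minus \<kappa>_def fun_eq_iff)
  have R_poly: "polynomial_function R"
  proof -
    have "polynomial_function (P \<circ> (\<lambda>v. - v))"
      by (intro polynomial_function_compose P polynomial_function_minus polynomial_function_id)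
    then show ?thesis unfolding R_def
      by (intro polynomial_function_cmul polynomial_function_diff P) (simp add: o_def)
  qed
  have R_cont: "continuous_on A R" for A
    by (rule continuous_on_polymonial_function[OF R_poly])
  have p_cont: "continuous_on A p" for A
  proof -
    have "continuous_on A \<iota>" unfolding \<iota>_def
      by (intro continuous_on_sum continuous_on_scaleR continuous_on_const
            continuous_on_product_then_coordinatewise[OF continuous_on_id])
    then have "continuous_on A (\<lambda>y. R (\<iota> y))"
      by (rule continuous_on_compose2[OF R_cont]) auto
    then have "continuous_on A (\<lambda>y. p y i)" for i
      unfolding p_def \<kappa>_def by (cases "i \<le> n") (auto intro!: continuous_intros)
    then show ?thesis
      by (rule continuous_on_coordinatewise_then_product)
  qed
  have p_near: "(\<Sum>i\<le>n. (p y i - g y i)\<^sup>2) < 1" if y: "y \<in> ?T" for y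
  proof -
    define v where "v = \<iota> y"
    have my: "(\<lambda>i. - y i) \<in> ?T" using y by (simp add: topspace_nsphere_iff)
    have "\<kappa> v = y" unfolding v_def using y by (intro \<kappa>_\<iota>) (simp add: topspace_nsphere_iff)
    moreover have "\<kappa> (- v) = (\<lambda>i. - y i)" unfolding v_def \<iota>_minus[symmetric]
      using my by (intro \<kappa>_\<iota>) (simp add: topspace_nsphere_iff)
    ultimately have 1: "norm (\<iota> (g y) - P v) < 1" "norm (- \<iota> (g y) - P (- v)) < 1"
      using Pg[of v] Pg[of "- v"] \<iota>_S[OF y] \<iota>_S[OF my] odd[OF y] by (auto simp: v_def \<iota>_minus)
    define e where "e = R v - \<iota> (g y)"
    have "e = (1/2) *\<^sub>R ((- \<iota> (g y) - P (- v)) - (\<iota> (g y) - P v))"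
      by (simp add: e_def R_def algebra_simps flip: scaleR_add_left)
    then have "norm e < 1"
      using 1 norm_triangle_ineq4[of "- \<iota> (g y) - P (- v)" "\<iota> (g y) - P v"] by simp
    then have "(norm e)\<^sup>2 < 1" by (simp add: power_less_one_iff)
    moreover have "(\<Sum>i\<le>n. (p y i - g y i)\<^sup>2) = (\<Sum>i\<le>n. (e \<bullet> b i)\<^sup>2)"
      by (intro sum.cong) (use n in \<open>auto simp: p_def \<kappa>_def e_def v_def inner_diff_left \<iota>_inner\<close>)
    ultimately show ?thesis using bessel[of e] by linarith
  qed
  \<comment> \<open>The cone over the image of the equator is thickened by the directions orthogonal to \<open>\<real>\<^sup>n\<^sup>+\<^sup>1\<close>.
    The result is the image under \<open>F\<close> of a subset of the hyperplane orthogonal to \<open>b n\<close>,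
    hence negligible: there \<open>F\<close> is a differentiable map into \<open>'a\<close> itself.\<close>
  define \<rho> where "\<rho> h = (\<Sum>i<n. (h \<bullet> b i) *\<^sub>R b i)" for h
  define F where "F h = norm (\<rho> h) *\<^sub>R \<pi> (R ((1 / norm (\<rho> h)) *\<^sub>R \<rho> h)) + (h - \<pi> h)" for h
  define H where "H = {h. b n \<bullet> h = 0 \<and> \<rho> h \<noteq> 0}"
  have bn: "b n \<noteq> 0" using bb[of n n] n by auto
  have F_diff: "F differentiable_on H"
    unfolding differentiable_on_def
  proof
    fix h assume "h \<in> H"
    then have h: "\<rho> h \<noteq> 0" by (simp add: H_def)
    have lin: "linear \<rho>" unfolding \<rho>_def
      by (intro linearI) (simp_all add: algebra_simps inner_add_left sum.distrib scaleR_sum_right)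
    have d\<rho>: "\<rho> differentiable (at h)" using lin by (rule linear_imp_differentiable)
    have d\<pi>: "\<pi> differentiable (at x)" for x using \<pi>_linear by (rule linear_imp_differentiable)
    have dn: "(\<lambda>h. norm (\<rho> h)) differentiable (at h)"
      by (rule differentiable_compose[of norm \<rho>, OF differentiable_norm_at[OF h] d\<rho>])
    have "(\<lambda>h. (1 / norm (\<rho> h)) *\<^sub>R \<rho> h) differentiable (at h)"
      by (intro differentiable_scaleR differentiable_divide dn d\<rho> differentiable_const) (use h in auto)
    then have "(\<lambda>h. \<pi> (R ((1 / norm (\<rho> h)) *\<^sub>R \<rho> h))) differentiable (at h)"
      by (intro differentiable_compose[of \<pi>, OF d\<pi>]
            differentiable_compose[of R, OF differentiable_at_polynomial_function[OF R_poly]])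
    then have "F differentiable (at h)"
      unfolding F_def by (intro differentiable_add differentiable_scaleR differentiable_diff dn d\<pi> differentiable_ident)
    then show "F differentiable (at h within H)" by (rule differentiable_at_withinI)
  qed
  have "negligible H"
    using negligible_hyperplane[of "b n" 0] bn by (auto simp: H_def intro: negligible_subset)
  then have "negligible (F ` H)"
    by (intro negligible_differentiable_image_negligible F_diff) auto
  moreover have "\<not> negligible {v. v \<bullet> b n > 0}"
  proof (rule open_not_negligible)
    show "open {v. v \<bullet> b n > 0}" by (intro open_Collect_less continuous_intros)
    show "{v. v \<bullet> b n > 0} \<noteq> {}" using bn by (metis (mono_tags, lifting) empty_iff inner_gt_zero_iff mem_Collect_eq)
  qed
  ultimately obtain a where a: "a \<bullet> b n > 0" "a \<notin> F ` H"
    by (metis (no_types, lifting) mem_Collect_eq negligible_subset subsetI)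
  \<comment> \<open>a positive multiple of \<open>a\<close> among the values on the equator would put \<open>a\<close> into the image of \<open>F\<close>\<close>
  have pos: False if x: "x \<in> ?T" "x n = 0" and s: "s > 0" and eq: "\<And>i. i \<le> n \<Longrightarrow> p x i = s * \<kappa> a i" for x s
  proof -
    define h where "h = (1/s) *\<^sub>R \<iota> x + (a - \<pi> a)"
    have hb: "h \<bullet> b i = (1/s) * x i" if "i \<le> n" for i
      using that n by (simp add: h_def inner_add_left inner_diff_left \<pi>_def \<iota>_inner \<kappa>_def)
    have \<pi>h: "\<pi> h = (1/s) *\<^sub>R \<iota> x"
      unfolding \<pi>_eq \<iota>_scale[symmetric] unfolding \<iota>_def by (intro sum.cong) (auto simp: hb)
    then have h1: "h - \<pi> h = a - \<pi> a" by (simp add: h_def)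
    have "\<rho> h = \<pi> h"
    proof -
      have "{..n} = insert n {..<n}" by auto
      then show ?thesis unfolding \<rho>_def \<pi>_eq using hb[of n] x by simp
    qed
    then have h2: "\<rho> h = (1/s) *\<^sub>R \<iota> x" using \<pi>h by simp
    have nx: "norm (\<iota> x) = 1" using \<iota>_S[OF x(1)] by (simp add: S_def)
    have "h \<in> H" using h2 nx s hb[of n] x by (auto simp: H_def inner_commute)
    moreover have "F h = a"
    proof -
      have "\<pi> (R (\<iota> x)) = \<iota> (p x)" by (simp add: \<pi>_def p_def)
      also have "\<dots> = s *\<^sub>R \<pi> a" unfolding \<pi>_def \<iota>_scale[symmetric] by (rule \<iota>_cong) (simp add: eq)
      finally show ?thesis unfolding F_def h1 unfolding h2 using nx s by simp
    qed
    ultimately show False using a(2) by blast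
  qed
  have avoid: "\<exists>i\<le>n. p x i \<noteq> s * \<kappa> a i" if x: "x \<in> ?T" "x n = 0" for x s
  proof (rule ccontr)
    assume "\<not> ?thesis"
    then have eq: "\<And>i. i \<le> n \<Longrightarrow> p x i = s * \<kappa> a i" by blast
    consider "s > 0" | "s < 0" | "s = 0" by linarith
    then show False
    proof cases
      case 1 then show False using pos[OF x] eq by blast
    next
      case 2
      have "(\<lambda>i. - x i) \<in> ?T" using x by (simp add: topspace_nsphere_iff)
      then show False using pos[of "\<lambda>i. - x i" "- s"] 2 x eq by (simp add: p_minus)
    next
      case 3
      then have "(\<Sum>i\<le>n. (p x i - g x i)\<^sup>2) = (\<Sum>i\<le>n. (g x i)\<^sup>2)" using eq by simp
      moreover have "g x \<in> ?T" using g x by (auto simp: continuous_map_nsphere_iff)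
      ultimately show False using p_near[OF x(1)] by (simp add: topspace_nsphere_iff)
    qed
  qed
  show thesis
  proof (rule that[of p "\<kappa> a"])
    show "\<kappa> a n > 0" using a by (simp add: \<kappa>_def)
  qed (use p_cont p_minus p_near avoid in \<open>auto simp: p_def \<kappa>_def\<close>)
qed


text \<open>
  Induction on the dimension.  With \<open>p\<close> and \<open>a\<close> from the previous lemma, subtract from \<open>p\<close> the
  multiple of \<open>a\<close> which cancels the last coordinate, damped by the even factor
  \<open>1 - x\<^sub>n\<^sup>2\<close>.  This factor is \<open>1\<close> exactly on the equator.  Hence the equator is mapped
  to the equator, and the deformation can only vanish where \<open>p\<close> lies on the line through \<open>a\<close>
  at a point of the equator, which is excluded.  Borsuk's degree step then reduces the claim to
  the equator.
\<close>

theorem odd_map_sphere_degree: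
  assumes n: "n < DIM('a::euclidean_space)"
    and g: "continuous_map (nsphere n) (nsphere n) g"
    and odd: "\<And>x. x \<in> topspace (nsphere n) \<Longrightarrow> g (\<lambda>i. - x i) = (\<lambda>i. - g x i)"
  shows "odd (Brouwer_degree2 n g)"
  using assms
proof (induction n arbitrary: g)
  case 0
  then show ?case by (intro odd_degree_nsphere_0)
next
  case (Suc m)
  define n where "n = Suc m"
  let ?T = "topspace (nsphere n)"
  note g = Suc.prems(2)[folded n_def] and odd = Suc.prems(3)[folded n_def]
  obtain p a where p: "continuous_on ?T p"
    and p0: "\<And>x i. i > n \<Longrightarrow> p x i = 0"
    and p_minus: "\<And>x. p (\<lambda>i. - x i) = (\<lambda>i. - p x i)"
    and near: "\<And>x. x \<in> ?T \<Longrightarrow> (\<Sum>i\<le>n. (p x i - g x i)\<^sup>2) < 1"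
    and an: "a n > 0" and a0: "\<And>i. i > n \<Longrightarrow> a i = 0"
    and avoid: "\<And>x s. x \<in> ?T \<Longrightarrow> x n = 0 \<Longrightarrow> \<exists>i\<le>n. p x i \<noteq> s * a i"
    using odd_map_near_avoiding_line[where 'a='a, OF Suc.prems(1)[folded n_def] g odd] by blast
  have gT: "g x \<in> ?T" if "x \<in> ?T" for x
    using g that by (auto simp: continuous_map_nsphere_iff)
  have g_cont: "continuous_on ?T g" using g by (simp add: continuous_map_nsphere_iff)
  \<comment> \<open>a zero on the segment would make \<open>p x\<close> differ from the unit vector \<open>g x\<close> by at least \<open>1\<close>\<close>
  have gp: "\<exists>i\<le>n. (1 - t) * g x i + t * p x i \<noteq> 0" if x: "x \<in> ?T" and t: "0 \<le> t" "t \<le> 1" for x t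
  proof (rule ccontr)
    assume "\<not> ?thesis"
    then have "g x i = t * (g x i - p x i)" if "i \<le> n" for i
      using that by (simp add: algebra_simps)
    then have "(\<Sum>i\<le>n. (g x i)\<^sup>2) = (\<Sum>i\<le>n. (t * (g x i - p x i))\<^sup>2)"
      by (intro sum.cong) auto
    also have "\<dots> = t\<^sup>2 * (\<Sum>i\<le>n. (p x i - g x i)\<^sup>2)"
      by (simp add: power_mult_distrib sum_distrib_left power2_commute)
    also have "\<dots> \<le> 1 * (\<Sum>i\<le>n. (p x i - g x i)\<^sup>2)"
      using t by (intro mult_right_mono sum_nonneg) (auto simp: power_le_one)
    finally show False using near[OF x] gT[OF x] by (simp add: topspace_nsphere_iff)
  qed
  define q where "q x = (\<lambda>i. p x i - (1 - (x n)\<^sup>2) * (p x n / a n) * a i)" for x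
  have q0: "q x i = 0" if "i > n" for x i using that by (simp add: q_def p0 a0)
  have q_minus: "q (\<lambda>i. - x i) = (\<lambda>i. - q x i)" for x by (auto simp: q_def p_minus)
  have q_cont: "continuous_on ?T q"
    unfolding q_def
    by (intro continuous_on_coordinatewise_then_product continuous_on_diff continuous_on_mult
          continuous_on_divide continuous_on_power continuous_on_const
          continuous_on_product_then_coordinatewise[OF p]
          continuous_on_product_then_coordinatewise[OF continuous_on_id]) (use an in auto)
  have pq: "\<exists>i\<le>n. (1 - t) * p x i + t * q x i \<noteq> 0" if x: "x \<in> ?T" and t: "0 \<le> t" "t \<le> 1" for x t
  proof (rule ccontr)
    assume neg: "\<not> ?thesis"
    define c where "c = t * (1 - (x n)\<^sup>2)"
    have eq: "p x i = c * (p x n / a n) * a i" if "i \<le> n" for i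
      using neg that by (auto simp: q_def c_def algebra_simps)
    \<comment> \<open>in the last coordinate, \<open>a\<close> contributes all of \<open>p x n\<close>, which forces the factor \<open>c\<close> to be \<open>1\<close>\<close>
    have "p x n = c * p x n" using eq[of n] an by simp
    moreover have "p x n \<noteq> 0"
    proof
      assume "p x n = 0"
      then have "p x i = 0" if "i \<le> n" for i using eq[OF that] by simp
      then show False using gp[OF x, of 1] by auto
    qed
    ultimately have "c = 1" by simp
    moreover have "t * (1 - (x n)\<^sup>2) \<le> 1 * (1 - (x n)\<^sup>2)"
    proof -
      have "(x n)\<^sup>2 \<le> (\<Sum>i\<le>n. (x i)\<^sup>2)" by (rule member_le_sum) auto
      then show ?thesis using t x by (intro mult_right_mono) (auto simp: topspace_nsphere_iff)
    qed
    ultimately have "x n = 0" by (simp add: c_def)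
    then show False using avoid[OF x, of "c * (p x n / a n)"] eq by blast
  qed
  define f where "f x = radial n (q x)" for x
  have q_nz: "\<exists>i\<le>n. q x i \<noteq> 0" if "x \<in> ?T" for x using pq[OF that, of 1] by simp
  have fT: "f x \<in> ?T" if "x \<in> ?T" for x
    unfolding f_def using q_nz[OF that] q0 by (intro radial_in_nsphere) auto
  have f_cont: "continuous_on ?T f"
    unfolding f_def by (intro continuous_on_radial q_cont q_nz)
  have f: "continuous_map (nsphere n) (nsphere n) f"
    using f_cont fT by (simp add: continuous_map_nsphere_iff)
  have f_minus: "f (\<lambda>i. - x i) = (\<lambda>i. - f x i)" for x by (simp add: f_def q_minus radial_minus)
  have "Brouwer_degree2 n g = Brouwer_degree2 n (\<lambda>x. radial n (g x))"
    by (intro Brouwer_degree2_eq) (simp add: radial_nsphere_id gT)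
  also have "\<dots> = Brouwer_degree2 n (\<lambda>x. radial n (p x))"
    by (intro Brouwer_degree2_segment_homotopy g_cont p gp) (use gT p0 in \<open>auto simp: topspace_nsphere_iff\<close>)
  also have "\<dots> = Brouwer_degree2 n f"
    unfolding f_def by (intro Brouwer_degree2_segment_homotopy q_cont p pq) (auto simp: p0 q0)
  finally have deg: "Brouwer_degree2 n g = Brouwer_degree2 n f" .
  have sub: "x \<in> ?T \<and> x n = 0" if "x \<in> topspace (nsphere m)" for x
    using that by (auto simp: topspace_nsphere_iff n_def)
  have fm: "f x \<in> topspace (nsphere m)" if "x \<in> topspace (nsphere m)" for x
  proof -
    have "f x n = 0" using sub[OF that] an by (simp add: f_def radial_def q_def)
    then show ?thesis using topspace_nsphere_minus1[of "f x" n] fT sub[OF that] by (simp add: n_def)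
  qed
  have "continuous_map (nsphere m) (nsphere m) f"
    using continuous_on_subset[OF f_cont, of "topspace (nsphere m)"] sub fm
    by (auto simp: continuous_map_nsphere_iff)
  then have "odd (Brouwer_degree2 m f)"
    using Suc.prems(1) by (intro Suc.IH) (auto simp: f_minus)
  moreover have "even (Brouwer_degree2 n f - Brouwer_degree2 (n - Suc 0) f)"
    by (rule Borsuk_odd_mapping_degree_step[OF f]) (use fm in \<open>auto simp: f_minus n_def\<close>)
  ultimately show ?case using deg by (simp add: n_def)
qed

section \<open>The Borsuk-Ulam theorem\<close>

text \<open>
  If \<open>m < dim S\<close>, then in orthonormal coordinates of \<open>S\<close> the projected map is an odd self-map of
  a sphere whose last coordinate vanishes.  It is not surjective, so its degree is \<open>0\<close>, which is
  even.
\<close>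

theorem Borsuk_Ulam_subspace:
  fixes S :: "'a::euclidean_space set"
  assumes S: "subspace S" and h: "odd_map_to_punctured m (S \<inter> sphere 0 1) h"
  shows "dim S \<le> m"
proof (rule ccontr)
  assume "\<not> dim S \<le> m"
  then obtain n where n: "dim S = Suc n" "m \<le> n" by (cases "dim S") auto
  obtain B where B: "B \<subseteq> S" "pairwise orthogonal B" "\<And>x. x \<in> B \<Longrightarrow> norm x = 1"
    "independent B" "card B = dim S" "span B = S"
    using orthonormal_basis_subspace[OF S] by metis
  have "finite B" using B(4) by (rule independent_imp_finite)
  then obtain b where b: "bij_betw b {..n} B"
    using ex_bij_betw_nat_finite[of B] B(5) n by (metis atLeast0LessThan lessThan_Suc_atMost)
  have bb: "b i \<bullet> b j = (if i = j then 1 else 0)" if "i \<le> n" "j \<le> n" for i j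
  proof (cases "i = j")
    case True
    have "b i \<in> B" using b that by (auto simp: bij_betw_def)
    then show ?thesis using True B(3)[of "b i"] by (simp add: norm_eq_1)
  next
    case False
    have "b i \<in> B" "b j \<in> B" "b i \<noteq> b j" using b that False by (auto simp: bij_betw_def inj_on_def)
    then show ?thesis using False B(2) by (auto simp: pairwise_def orthogonal_def)
  qed
  define \<iota> where "\<iota> x = (\<Sum>i\<le>n. x i *\<^sub>R b i)" for x :: "nat \<Rightarrow> real"
  have "norm (\<iota> x) = 1" if "x \<in> topspace (nsphere n)" for x
  proof -
    have "\<iota> x \<bullet> \<iota> x = (\<Sum>i\<le>n. \<Sum>j\<le>n. if j = i then x i * x i else 0)"
      unfolding \<iota>_def inner_sum_left inner_sum_right by (intro sum.cong refl) (auto simp: bb)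
    also have "\<dots> = 1" using that by (simp add: topspace_nsphere_iff power2_eq_square)
    finally show ?thesis by (simp add: norm_eq_1)
  qed
  moreover have "\<iota> x \<in> S" for x
    unfolding \<iota>_def using b B(1) by (intro subspace_sum subspace_scale S) (auto simp: bij_betw_def)
  ultimately have \<iota>: "\<iota> x \<in> S \<inter> sphere 0 1" if "x \<in> topspace (nsphere n)" for x using that by auto
  have \<iota>_minus: "\<iota> (\<lambda>i. - x i) = - \<iota> x" for x by (simp add: \<iota>_def sum_negf)
  have \<iota>_cont: "continuous_on A \<iota>" for A
    unfolding \<iota>_def
    by (intro continuous_on_sum continuous_on_scaleR continuous_on_const
          continuous_on_product_then_coordinatewise[OF continuous_on_id])
  have hE: "continuous_on (S \<inter> sphere 0 1) h"
    "\<And>v. v \<in> S \<inter> sphere 0 1 \<Longrightarrow> (\<forall>i\<ge>m. h v i = 0) \<and> h v \<noteq> (\<lambda>i. 0)"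
    and h_minus: "\<And>v. v \<in> S \<inter> sphere 0 1 \<Longrightarrow> h (- v) = (\<lambda>i. - h v i)"
  proof -
    have "continuous_map (top_of_set (S \<inter> sphere 0 1)) (top_of_set ({x. \<forall>i\<ge>m. x i = 0} \<inter> - {\<lambda>i. 0})) h"
      using h by (simp only: odd_map_to_punctured_def Euclidean_space_def euclidean_product_topology subtopology_subtopology)
    then show "continuous_on (S \<inter> sphere 0 1) h"
      "\<And>v. v \<in> S \<inter> sphere 0 1 \<Longrightarrow> (\<forall>i\<ge>m. h v i = 0) \<and> h v \<noteq> (\<lambda>i. 0)" by auto
    show "\<And>v. v \<in> S \<inter> sphere 0 1 \<Longrightarrow> h (- v) = (\<lambda>i. - h v i)" using h by (simp add: odd_map_to_punctured_def)
  qed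
  define f where "f x = radial n (h (\<iota> x))" for x
  have nz: "\<exists>i\<le>n. h (\<iota> x) i \<noteq> 0" if x: "x \<in> topspace (nsphere n)" for x
  proof -
    obtain i where i: "h (\<iota> x) i \<noteq> 0" using hE(2)[OF \<iota>[OF x]] by blast
    then have "i < m" using hE(2)[OF \<iota>[OF x]] not_less by blast
    then show ?thesis using i n by (intro exI[of _ i]) auto
  qed
  have f: "continuous_map (nsphere n) (nsphere n) f"
    unfolding continuous_map_nsphere_iff f_def
  proof (intro conjI continuous_on_radial nz Pi_I radial_in_nsphere)
    show "continuous_on (topspace (nsphere n)) (\<lambda>x. h (\<iota> x))"
      by (rule continuous_on_compose2[OF hE(1) \<iota>_cont]) (use \<iota> in auto)
  qed (use hE(2)[OF \<iota>] n in auto)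
  have "n < DIM('a)" using n dim_subset_UNIV[of S] by simp
  then have "odd (Brouwer_degree2 n f)"
    by (rule odd_map_sphere_degree) (use f in \<open>auto simp: f_def \<iota>_minus h_minus[OF \<iota>] radial_minus\<close>)
  moreover have "Brouwer_degree2 n f = 0"
  proof (rule Brouwer_degree2_nonsurjective[OF f])
    define e :: "nat \<Rightarrow> real" where "e = (\<lambda>i. if i = n then 1 else 0)"
    have "e \<in> topspace (nsphere n)"
      by (simp add: topspace_nsphere_iff e_def if_distrib[of "\<lambda>x. x\<^sup>2"] cong: if_cong)
    moreover have "f x n = 0" if "x \<in> topspace (nsphere n)" for x
      using hE(2)[OF \<iota>[OF that]] n by (simp add: f_def radial_def)
    then have "e \<noteq> f x" if "x \<in> topspace (nsphere n)" for x
      using that by (auto simp: e_def fun_eq_iff intro!: exI[of _ n])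
    then have "e \<notin> f ` topspace (nsphere n)" by blast
    ultimately show "f ` topspace (nsphere n) \<noteq> topspace (nsphere n)" by blast
  qed
  ultimately show False by simp
qed


section \<open>Connected components of vertex sets\<close>

lemma connected_subset_Un:
  assumes "connected_subset E A" "connected_subset E B" "A \<inter> B \<noteq> {}"
  shows "connected_subset E (A \<union> B)"
proof -
  let ?R = "\<lambda>S. {(x, y). x \<in> S \<and> y \<in> S \<and> {x, y} \<in> E}"
  obtain c where c: "c \<in> A" "c \<in> B" using assms(3) by blast
  have "(?R A)\<^sup>* \<subseteq> (?R (A \<union> B))\<^sup>*" "(?R B)\<^sup>* \<subseteq> (?R (A \<union> B))\<^sup>*" by (auto intro!: rtrancl_mono)
  then have "(u, c) \<in> (?R (A \<union> B))\<^sup>* \<and> (c, u) \<in> (?R (A \<union> B))\<^sup>*" if "u \<in> A \<union> B" for u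
    using assms(1,2) c that unfolding connected_subset_def by blast
  then have "(u, v) \<in> (?R (A \<union> B))\<^sup>*" if "u \<in> A \<union> B" "v \<in> A \<union> B" for u v
    using that by (meson rtrancl_trans)
  then show ?thesis using c unfolding connected_subset_def by blast
qed

lemma connected_component_inD:
  assumes "connected_component_in E S A"
  shows "A \<subseteq> S" "connected_subset E A"
  using assms by (simp_all add: connected_component_in_def)

text \<open>
  The working form of maximality: disjointness of components and the behaviour of edges that
  leave a component are both special cases.
\<close>

lemma connected_component_in_absorb:
  assumes "connected_component_in E S A" "connected_subset E B" "B \<subseteq> S" "A \<inter> B \<noteq> {}"
  shows "B \<subseteq> A"
proof -
  have "connected_subset E (A \<union> B)"
    using assms by (intro connected_subset_Un) (auto simp: connected_component_in_def)
  then have "A \<union> B = A" using assms unfolding connected_component_in_def by (metis Un_least Un_upper1)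
  then show ?thesis by blast
qed

lemma connected_component_in_eq:
  assumes "connected_component_in E S A" "connected_component_in E S B" "A \<inter> B \<noteq> {}"
  shows "A = B"
  using connected_component_in_absorb[OF assms(1), of B] connected_component_in_absorb[OF assms(2), of A] assms
  by (auto simp: connected_component_in_def)

lemma connected_component_in_edge:
  assumes "connected_component_in E S A" "u \<in> A" "v \<in> S" "{u, v} \<in> E"
  shows "v \<in> A"
proof -
  have "connected_subset E {u, v}"
    unfolding connected_subset_def using assms(4) by (auto simp: insert_commute)
  then show ?thesis
    using connected_component_in_absorb[OF assms(1), of "{u, v}"] assms by (auto simp: connected_component_in_def)
qed

lemma connected_component_in_exists:
  fixes S :: "'v::finite set"
  assumes "u \<in> S"
  obtains A where "connected_component_in E S A" "u \<in> A"
proof -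
  let ?P = "\<lambda>A. u \<in> A \<and> A \<subseteq> S \<and> connected_subset E A"
  have "?P {u}" using assms by (auto simp: connected_subset_def)
  moreover have "\<forall>B. ?P B \<longrightarrow> card B < Suc (CARD('v))" by (simp add: less_Suc_eq_le card_mono)
  ultimately have "\<exists>A. ?P A \<and> (\<forall>B. ?P B \<longrightarrow> card B \<le> card A)"
    by (rule ex_has_greatest_nat)
  then obtain A where A: "?P A" "\<And>B. ?P B \<Longrightarrow> card B \<le> card A" by blast
  have "connected_component_in E S A"
    unfolding connected_component_in_def
  proof (intro conjI allI impI)
    fix B assume B: "A \<subseteq> B \<and> B \<subseteq> S \<and> connected_subset E B"
    then have "card B \<le> card A" using A by blast
    then show "B = A" using B by (metis card_seteq finite)
  qed (use A in auto)
  then show ?thesis using that A by blast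
qed

section \<open>Boundary weights and the eigenvalue equation\<close>

definition weighted_norm1 :: "('v::finite \<Rightarrow> real) \<Rightarrow> real^'v \<Rightarrow> real" where
  "weighted_norm1 \<mu> g = (\<Sum>u\<in>UNIV. \<mu> u * \<bar>g $ u\<bar>)"

section \<open>Genus of linear sections of the weighted sphere\<close>

lemma sphere1_eq: "sphere1 \<mu> = {g. weighted_norm1 \<mu> g = 1}"
  by (simp add: sphere1_def weighted_norm1_def)

lemma weighted_norm1_pos:
  assumes "\<And>u. \<mu> u > 0" "g \<noteq> 0"
  shows "weighted_norm1 \<mu> g > 0"
proof -
  obtain u where "g $ u \<noteq> 0" using assms(2) by (metis vec_eq_iff zero_index)
  moreover have "0 \<le> \<mu> v * \<bar>g $ v\<bar>" for v using assms(1)[of v] by simp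
  ultimately show ?thesis unfolding weighted_norm1_def
    by (intro sum_pos2[of _ u]) (use assms(1) in auto)
qed

definition boundary_weight :: "('v::finite \<Rightarrow> 'v \<Rightarrow> real) \<Rightarrow> 'v set \<Rightarrow> real" where
  "boundary_weight w A = (\<Sum>u\<in>A. \<Sum>v\<in>-A. w u v)"

lemma (in connected_weighted_graph) weight_nonneg: "w u v \<ge> 0"
  using weight_pos weight_zero by (metis less_imp_le order_refl)

lemma Sign_mult_self: "s \<in> Sign x \<Longrightarrow> s * x = \<bar>x\<bar>"
  by (auto simp: Sign_def split: if_splits)

lemma Sign_le_1: "s \<in> Sign x \<Longrightarrow> s \<le> 1"
  by (auto simp: Sign_def split: if_splits)

text \<open>
  Pairing the eigenvalue equation with \<open>f\<close> turns the left-hand side into a sum of terms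
  \<open>w u v * \<bar>f u - f v\<bar>\<close> and the right-hand side into \<open>l\<close> times the weighted norm of \<open>f\<close>.
\<close>

lemma (in connected_weighted_graph) eigenvalue_nonneg:
  assumes "eigenpair1 w \<mu> f l"
  shows "l \<ge> 0"
proof -
  obtain z where f: "f \<noteq> 0" and z: "\<And>u v. z u v = - z v u" "\<And>u v. z u v \<in> Sign (f $ u - f $ v)"
    and eq: "\<And>u. (\<Sum>v\<in>UNIV. w u v * z u v) \<in> (\<lambda>s. l * \<mu> u * s) ` Sign (f $ u)"
    using assms unfolding eigenpair1_def by metis
  have 1: "f $ u * (\<Sum>v\<in>UNIV. w u v * z u v) = l * (\<mu> u * \<bar>f $ u\<bar>)" for u
  proof -
    obtain s where "s \<in> Sign (f $ u)" "(\<Sum>v\<in>UNIV. w u v * z u v) = l * \<mu> u * s" using eq by blast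
    then show ?thesis using Sign_mult_self[of s "f $ u"] by (simp add: algebra_simps)
  qed
  let ?X = "\<Sum>u\<in>UNIV. \<Sum>v\<in>UNIV. w u v * z u v * f $ u"
  have "?X = (\<Sum>v\<in>UNIV. \<Sum>u\<in>UNIV. w u v * z u v * f $ u)" by (rule sum.swap)
  also have "\<dots> = - (\<Sum>u\<in>UNIV. \<Sum>v\<in>UNIV. w u v * z u v * f $ v)"
    unfolding sum_negf[symmetric]
    by (intro sum.cong refl) (use weight_sym z(1) in \<open>metis minus_mult_left minus_mult_right\<close>)
  finally have "2 * ?X = (\<Sum>u\<in>UNIV. \<Sum>v\<in>UNIV. w u v * z u v * (f $ u - f $ v))"
    by (simp add: right_diff_distrib sum_subtractf)
  also have "\<dots> \<ge> 0"
  proof (intro sum_nonneg)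
    fix u v
    have "z u v * (f $ u - f $ v) \<ge> 0" using Sign_mult_self[OF z(2)[of u v]] by simp
    then show "w u v * z u v * (f $ u - f $ v) \<ge> 0" using weight_nonneg[of u v] by (simp add: mult.assoc)
  qed
  finally have "0 \<le> ?X" by simp
  also have "?X = (\<Sum>u\<in>UNIV. f $ u * (\<Sum>v\<in>UNIV. w u v * z u v))"
    by (simp add: sum_distrib_left algebra_simps)
  also have "\<dots> = l * (\<Sum>u\<in>UNIV. \<mu> u * \<bar>f $ u\<bar>)" 
    unfolding sum_distrib_left[of l] by (intro sum.cong refl 1)
  finally have "0 \<le> l * (\<Sum>u\<in>UNIV. \<mu> u * \<bar>f $ u\<bar>)" .
  moreover have "(\<Sum>u\<in>UNIV. \<mu> u * \<bar>f $ u\<bar>) > 0"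
    using weighted_norm1_pos[of \<mu>, OF vertex_weight_pos f] by (simp add: weighted_norm1_def)
  ultimately show ?thesis by (simp add: zero_le_mult_iff)
qed

text \<open>
  Sum the eigenvalue equation over \<open>A\<close>.  The flow \<open>w u v * z u v\<close> cancels inside \<open>A\<close> by
  antisymmetry and equals \<open>w u v\<close> on the edges that leave \<open>A\<close>, since \<open>f\<close> drops there.  The
  right-hand side is at most \<open>l * \<mu> u\<close> at each vertex, also where \<open>f u = 0\<close>, because
  \<open>l \<ge> 0\<close>.
\<close>

lemma (in connected_weighted_graph) boundary_weight_le:
  assumes ep: "eigenpair1 w \<mu> f l"
    and leave: "\<And>u v. u \<in> A \<Longrightarrow> v \<notin> A \<Longrightarrow> {u, v} \<in> E \<Longrightarrow> f $ v < f $ u"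
  shows "boundary_weight w A \<le> l * (\<Sum>u\<in>A. \<mu> u)"
proof -
  obtain z where z: "\<And>u v. z u v = - z v u" "\<And>u v. z u v \<in> Sign (f $ u - f $ v)"
    and eq: "\<And>u. (\<Sum>v\<in>UNIV. w u v * z u v) \<in> (\<lambda>s. l * \<mu> u * s) ` Sign (f $ u)"
    using ep unfolding eigenpair1_def by metis
  let ?X = "\<Sum>u\<in>A. \<Sum>v\<in>A. w u v * z u v"
  have "?X = (\<Sum>v\<in>A. \<Sum>u\<in>A. w u v * z u v)" by (rule sum.swap)
  also have "\<dots> = - ?X"
    unfolding sum_negf[symmetric]
    by (intro sum.cong refl) (use weight_sym z(1) in \<open>metis minus_mult_right\<close>)
  finally have inner: "?X = 0" by simp
  have wz: "w u v * z u v = w u v" if "u \<in> A" "v \<in> - A" for u v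
  proof (cases "{u, v} \<in> E")
    case True
    then show ?thesis using leave[of u v] z(2)[of u v] that by (simp add: Sign_def)
  qed (simp add: weight_zero)
  have "boundary_weight w A = (\<Sum>u\<in>A. \<Sum>v\<in>-A. w u v * z u v)"
    unfolding boundary_weight_def by (intro sum.cong refl wz[symmetric])
  also have "\<dots> = (\<Sum>u\<in>A. (\<Sum>v\<in>A. w u v * z u v) + (\<Sum>v\<in>-A. w u v * z u v))"
    using inner by (simp add: sum.distrib)
  also have "\<dots> = (\<Sum>u\<in>A. \<Sum>v\<in>UNIV. w u v * z u v)"
    by (intro sum.cong refl) (metis Compl_disjoint Compl_partition finite sum.union_disjoint)
  also have "\<dots> \<le> (\<Sum>u\<in>A. l * \<mu> u)"
  proof (intro sum_mono)
    fix u
    obtain s where s: "s \<in> Sign (f $ u)" "(\<Sum>v\<in>UNIV. w u v * z u v) = l * \<mu> u * s" using eq by blast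
    have "l * \<mu> u \<ge> 0" using eigenvalue_nonneg[OF ep] vertex_weight_pos[of u] by simp
    then show "(\<Sum>v\<in>UNIV. w u v * z u v) \<le> l * \<mu> u"
      using s Sign_le_1[OF s(1)] mult_left_le by auto
  qed
  finally show ?thesis by (simp add: sum_distrib_left)
qed

lemma eigenpair1_minus:
  assumes "eigenpair1 w \<mu> f l"
  shows "eigenpair1 w \<mu> (- f) l"
proof -
  obtain z where f: "f \<noteq> 0" and z: "\<And>u v. z u v = - z v u" "\<And>u v. z u v \<in> Sign (f $ u - f $ v)"
    and eq: "\<And>u. (\<Sum>v\<in>UNIV. w u v * z u v) \<in> (\<lambda>s. l * \<mu> u * s) ` Sign (f $ u)"
    using assms unfolding eigenpair1_def by metis
  have Sm: "- s \<in> Sign (- x)" if "s \<in> Sign x" for s x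
    using that by (auto simp: Sign_def split: if_splits)
  show ?thesis
    unfolding eigenpair1_def
  proof (intro conjI exI[of _ "\<lambda>u v. - z u v"] allI)
    fix u v
    show "- z u v = - (- z v u)" using z(1)[of u v] by simp
    show "- z u v \<in> Sign ((- f) $ u - (- f) $ v)" using Sm[OF z(2)[of u v]] by simp
    obtain s where "s \<in> Sign (f $ u)" "(\<Sum>v\<in>UNIV. w u v * z u v) = l * \<mu> u * s" using eq by blast
    then show "(\<Sum>v\<in>UNIV. w u v * - z u v) \<in> (\<lambda>s. l * \<mu> u * s) ` Sign ((- f) $ u)"
      using Sm[of s "f $ u"] by (intro image_eqI[of _ _ "- s"]) (simp_all add: sum_negf)
  qed (use f in simp)
qed

section \<open>Disjoint representatives of the nodal domains\<close>

text \<open>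
  Weak nodal domains of opposite sign may overlap in zeros of \<open>f\<close>, which would spoil the norm of a
  combination of their indicators.  The strong domains, together with those weak domains that
  contain no strong one, are disjoint, and each weak domain can be given a member of its own.
\<close>

definition nodal_family :: "'v::finite set set \<Rightarrow> real^'v \<Rightarrow> 'v set set" where
  "nodal_family E f =
     strong_nodal_domains E f \<union> {A \<in> weak_nodal_domains E f. \<forall>u\<in>A. f $ u = 0}"

lemma strong_nodal_domains_minus: "strong_nodal_domains E (- f) = strong_nodal_domains E f"
  by (auto simp: strong_nodal_domains_def)

lemma weak_nodal_domains_minus: "weak_nodal_domains E (- f) = weak_nodal_domains E f"
  by (auto simp: weak_nodal_domains_def)

lemma nodal_family_minus: "nodal_family E (- f) = nodal_family E f"
  by (simp add: nodal_family_def strong_nodal_domains_minus weak_nodal_domains_minus)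

lemma nodal_family_nonempty: "A \<in> nodal_family E f \<Longrightarrow> A \<noteq> {}"
  by (auto simp: nodal_family_def strong_nodal_domains_def weak_nodal_domains_def
      connected_component_in_def connected_subset_def)

lemma strong_nodal_domain_nonzero:
  "A \<in> strong_nodal_domains E f \<Longrightarrow> u \<in> A \<Longrightarrow> f $ u \<noteq> 0"
  by (auto simp: strong_nodal_domains_def dest!: connected_component_inD(1))

text \<open>
  Two members that share a zero of \<open>f\<close> are both connected sets of zeros, so each lies in both
  \<open>{f \<ge> 0}\<close> and \<open>{f \<le> 0}\<close> and is absorbed by the other, whatever their signs.  Two members that
  share a vertex with \<open>f \<noteq> 0\<close> are strong domains of the same sign.
\<close>

lemma nodal_family_disjoint:
  assumes "A \<in> nodal_family E f" "B \<in> nodal_family E f" "A \<noteq> B"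
  shows "A \<inter> B = {}"
proof (rule ccontr)
  assume "A \<inter> B \<noteq> {}"
  then obtain c where c: "c \<in> A" "c \<in> B" by blast
  show False
  proof (cases "f $ c = 0")
    case True
    have zero: "C \<in> weak_nodal_domains E f \<and> (\<forall>u\<in>C. f $ u = 0)" if "C \<in> nodal_family E f" "c \<in> C" for C
      using that True strong_nodal_domain_nonzero[of C E f c] by (auto simp: nodal_family_def)
    have "C \<subseteq> D" if "C \<in> nodal_family E f" "D \<in> nodal_family E f" "c \<in> C" "c \<in> D" for C D
    proof -
      have C: "connected_subset E C" "\<forall>u\<in>C. f $ u = 0"
        using zero[of C] that by (auto simp: weak_nodal_domains_def dest: connected_component_inD)
      from zero[of D] that consider "connected_component_in E {u. f $ u \<ge> 0} D"
        | "connected_component_in E {u. f $ u \<le> 0} D" by (auto simp: weak_nodal_domains_def)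
      then show ?thesis
      proof cases
        case 1 show ?thesis by (rule connected_component_in_absorb[OF 1 C(1)]) (use C that in auto)
      next
        case 2 show ?thesis by (rule connected_component_in_absorb[OF 2 C(1)]) (use C that in auto)
      qed
    qed
    then show False using c assms by blast
  next
    case False
    have "C \<in> strong_nodal_domains E f" if "C \<in> nodal_family E f" "c \<in> C" for C
      using that False by (auto simp: nodal_family_def)
    then have "A \<in> strong_nodal_domains E f" "B \<in> strong_nodal_domains E f" using assms c by auto
    then consider
        "connected_component_in E {u. f $ u > 0} A" "connected_component_in E {u. f $ u > 0} B"
      | "connected_component_in E {u. f $ u < 0} A" "connected_component_in E {u. f $ u < 0} B"
      using c by (fastforce simp: strong_nodal_domains_def dest: connected_component_inD(1))
    then show False
      by cases (use connected_component_in_eq \<open>A \<inter> B \<noteq> {}\<close> assms(3) in blast)+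
  qed
qed

text \<open>
  An edge leaving a component of \<open>{f > 0}\<close> ends where \<open>f \<le> 0\<close>; an edge leaving a
  component of \<open>{f \<ge> 0}\<close> ends where \<open>f < 0\<close>.  So \<open>f\<close> drops along the edge in both cases.  The
  other sign follows by passing to \<open>- f\<close>.
\<close>

lemma (in connected_weighted_graph) nodal_family_boundary_weight_le:
  assumes ep: "eigenpair1 w \<mu> f l" and A: "A \<in> nodal_family E f"
  shows "boundary_weight w A \<le> l * (\<Sum>u\<in>A. \<mu> u)"
proof -
  have pos: "boundary_weight w A \<le> l * (\<Sum>u\<in>A. \<mu> u)"
    if g: "eigenpair1 w \<mu> g l" and comp: "connected_component_in E {u. g $ u > 0} A \<or>
         connected_component_in E {u. g $ u \<ge> 0} A \<and> (\<forall>u\<in>A. g $ u = 0)" for g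
  proof (rule boundary_weight_le[OF g])
    fix u v assume uv: "u \<in> A" "v \<notin> A" "{u, v} \<in> E"
    from comp show "g $ v < g $ u"
    proof
      assume A: "connected_component_in E {u. g $ u > 0} A"
      then have "g $ u > 0" using uv by (auto dest: connected_component_inD)
      moreover have "\<not> g $ v > 0" using connected_component_in_edge[OF A] uv by auto
      ultimately show ?thesis by simp
    next
      assume A: "connected_component_in E {u. g $ u \<ge> 0} A \<and> (\<forall>u\<in>A. g $ u = 0)"
      then have "\<not> g $ v \<ge> 0" using connected_component_in_edge[of E _ A u v] uv by auto
      then show ?thesis using A uv by simp
    qed
  qed
  from A consider "connected_component_in E {u. f $ u > 0} A"
    | "connected_component_in E {u. f $ u < 0} A"
    | "connected_component_in E {u. f $ u \<ge> 0} A \<and> (\<forall>u\<in>A. f $ u = 0)"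
    | "connected_component_in E {u. f $ u \<le> 0} A \<and> (\<forall>u\<in>A. f $ u = 0)"
    by (auto simp: nodal_family_def strong_nodal_domains_def weak_nodal_domains_def)
  then show ?thesis
    by cases (use pos[OF ep] pos[OF eigenpair1_minus[OF ep]] in simp_all)
qed

lemma weak_nodal_domain_contains:
  assumes "W \<in> weak_nodal_domains E f"
  shows "W \<in> nodal_family E f \<or> (\<exists>A\<in>strong_nodal_domains E f. A \<subseteq> W)"
proof -
  have pos: "\<exists>A\<in>strong_nodal_domains E g. A \<subseteq> W"
    if W: "connected_component_in E {u. g $ u \<ge> 0} W" and u: "u \<in> W" "g $ u \<noteq> 0" for g u
  proof -
    have "g $ u > 0" using connected_component_inD(1)[OF W] u by force
    then obtain A where A: "connected_component_in E {u. g $ u > 0} A" "u \<in> A"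
      using connected_component_in_exists[of u "{u. g $ u > 0}"] by auto
    have "A \<subseteq> W"
      by (rule connected_component_in_absorb[OF W])
        (use connected_component_inD[OF A(1)] A(2) u in \<open>auto intro: less_imp_le\<close>)
    then show ?thesis using A by (auto simp: strong_nodal_domains_def)
  qed
  show ?thesis
  proof (cases "\<forall>u\<in>W. f $ u = 0")
    case True
    then show ?thesis using assms by (simp add: nodal_family_def)
  next
    case False
    then obtain u where u: "u \<in> W" "f $ u \<noteq> 0" by blast
    then show ?thesis
      using assms pos[of f u] pos[of "- f" u] by (auto simp: weak_nodal_domains_def strong_nodal_domains_minus)
  qed
qed

text \<open>
  Assign to every weak domain a member of the family inside it, the domain itself if \<open>f\<close> vanishes
  there.  Domains of the same sign are disjoint, so they get different members.  Domains of
  opposite sign meet only in zeros of \<open>f\<close>; a common member is then not a strong domain and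
  coincides with both.
\<close>

lemma card_weak_nodal_domains_le: "card (weak_nodal_domains E f) \<le> card (nodal_family E f)"
proof -
  let ?W = "weak_nodal_domains E f"
  define \<phi> where "\<phi> W = (if W \<in> nodal_family E f then W
      else SOME A. A \<in> strong_nodal_domains E f \<and> A \<subseteq> W)" for W
  have \<phi>: "\<phi> W = W \<or> \<phi> W \<in> strong_nodal_domains E f" "\<phi> W \<in> nodal_family E f" "\<phi> W \<subseteq> W" if "W \<in> ?W" for W
  proof -
    have "W \<in> nodal_family E f \<and> \<phi> W = W \<or> \<phi> W \<in> strong_nodal_domains E f \<and> \<phi> W \<subseteq> W"
      using weak_nodal_domain_contains[OF that] someI_ex[of "\<lambda>A. A \<in> strong_nodal_domains E f \<and> A \<subseteq> W"]
      by (auto simp: \<phi>_def)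
    then show "\<phi> W = W \<or> \<phi> W \<in> strong_nodal_domains E f" "\<phi> W \<in> nodal_family E f" "\<phi> W \<subseteq> W"
      by (auto simp: nodal_family_def)
  qed
  have "inj_on \<phi> ?W"
  proof (rule inj_onI)
    fix W W' assume W: "W \<in> ?W" "W' \<in> ?W" and eq: "\<phi> W = \<phi> W'"
    obtain c where c: "c \<in> \<phi> W" using nodal_family_nonempty[OF \<phi>(2)[OF W(1)]] by blast
    then have cW: "c \<in> W" "c \<in> W'" using \<phi>(3) W eq by auto
    consider (same) S where "connected_component_in E S W" "connected_component_in E S W'"
      | (opposite) "\<forall>u\<in>W \<inter> W'. f $ u = 0"
      using W unfolding weak_nodal_domains_def
      by (fastforce dest: connected_component_inD(1))
    then show "W = W'"
    proof cases
      case same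
      then show ?thesis using cW by (intro connected_component_in_eq) auto
    next
      case opposite
      then have "\<phi> W \<notin> strong_nodal_domains E f"
        using c cW strong_nodal_domain_nonzero by blast
      then show ?thesis using \<phi>(1) W eq by metis
    qed
  qed
  moreover have "\<phi> ` ?W \<subseteq> nodal_family E f" using \<phi>(2) by blast
  ultimately show ?thesis by (intro card_inj_on_le) auto
qed


lemma weighted_norm1_scaleR: "weighted_norm1 \<mu> (c *\<^sub>R g) = \<bar>c\<bar> * weighted_norm1 \<mu> g"
  by (simp add: weighted_norm1_def abs_mult sum_distrib_left algebra_simps)

lemma continuous_on_weighted_norm1: "continuous_on A (weighted_norm1 \<mu>)"
  unfolding weighted_norm1_def by (intro continuous_intros)

lemma weighted_norm1_minus: "weighted_norm1 \<mu> (- g) = weighted_norm1 \<mu> g"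
  by (simp add: weighted_norm1_def)

text \<open>
  Rescaling is an odd map from the Euclidean unit sphere of \<open>S\<close> to the weighted one, so an odd
  map on the latter gives one on the former, to which the Borsuk-Ulam theorem applies.
\<close>

lemma dim_le_genus:
  fixes S :: "(real^'v::finite) set"
  assumes \<mu>: "\<And>u. \<mu> u > 0" and S: "subspace S"
  shows "enat (dim S) \<le> genus (S \<inter> sphere1 \<mu>)"
proof (cases "S \<inter> sphere1 \<mu> = {}")
  case True
  have "x = 0" if "x \<in> S" for x
  proof (rule ccontr)
    assume "x \<noteq> 0"
    then have "(1 / weighted_norm1 \<mu> x) *\<^sub>R x \<in> S \<inter> sphere1 \<mu>"
      using weighted_norm1_pos[of \<mu> x] \<mu> S that
      by (simp add: sphere1_eq weighted_norm1_scaleR subspace_scale)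
    then show False using True by blast
  qed
  then have "dim S = 0" by (auto simp: dim_eq_0)
  then have "enat (dim S) = 0" by (simp only: zero_enat_def)
  then show ?thesis by (simp only: zero_le)
next
  case False
  have "dim S \<le> m" if h: "odd_map_to_punctured m (S \<inter> sphere1 \<mu>) h" for m h
  proof -
    let ?r = "\<lambda>x. (1 / weighted_norm1 \<mu> x) *\<^sub>R x"
    have pos: "weighted_norm1 \<mu> x > 0" if "x \<in> S \<inter> sphere 0 1" for x
      using that by (intro weighted_norm1_pos \<mu>) auto
    have r: "?r x \<in> S \<inter> sphere1 \<mu>" if "x \<in> S \<inter> sphere 0 1" for x
      using pos[OF that] that S by (simp add: sphere1_eq weighted_norm1_scaleR subspace_scale)
    have "continuous_on (S \<inter> sphere 0 1) ?r"
      by (intro continuous_intros continuous_on_weighted_norm1) (use pos in force)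
    then have "continuous_map (top_of_set (S \<inter> sphere 0 1)) (top_of_set (S \<inter> sphere1 \<mu>)) ?r"
      using r by auto
    then have "continuous_map (top_of_set (S \<inter> sphere 0 1))
        (subtopology (Euclidean_space m) (- {\<lambda>i. 0})) (h \<circ> ?r)"
      using h unfolding odd_map_to_punctured_def by (blast intro: continuous_map_compose)
    then have "odd_map_to_punctured m (S \<inter> sphere 0 1) (h \<circ> ?r)"
      using h r by (simp add: odd_map_to_punctured_def weighted_norm1_minus)
    then show ?thesis by (rule Borsuk_Ulam_subspace[OF S])
  qed
  then show ?thesis using False by (auto simp: genus_def intro!: Inf_greatest)
qed

lemma subspace_Int_sphere1_in_genus_family:
  fixes S :: "(real^'v::finite) set"
  assumes \<mu>: "\<And>u. \<mu> u > 0" and S: "subspace S" and k: "k \<le> dim S"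
  shows "S \<inter> sphere1 \<mu> \<in> genus_family \<mu> k"
  unfolding genus_family_def
proof (intro CollectI conjI)
  show "S \<inter> sphere1 \<mu> \<subseteq> sphere1 \<mu>" by simp
  have sym: "- x \<in> S \<inter> sphere1 \<mu>" if "x \<in> S \<inter> sphere1 \<mu>" for x
    using that S by (simp add: sphere1_eq weighted_norm1_minus subspace_neg)
  show "uminus ` (S \<inter> sphere1 \<mu>) = S \<inter> sphere1 \<mu>"
  proof (intro equalityI subsetI)
    fix x assume "x \<in> uminus ` (S \<inter> sphere1 \<mu>)"
    then show "x \<in> S \<inter> sphere1 \<mu>" using sym by blast
  next
    fix x assume "x \<in> S \<inter> sphere1 \<mu>"
    then have "- (- x) \<in> uminus ` (S \<inter> sphere1 \<mu>)" by (intro imageI sym)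
    then show "x \<in> uminus ` (S \<inter> sphere1 \<mu>)" by simp
  qed
  have "closed (sphere1 \<mu>)"
    unfolding sphere1_eq by (intro closed_Collect_eq continuous_on_weighted_norm1 continuous_on_const)
  then show "closed (S \<inter> sphere1 \<mu>)" by (rule closed_Int[OF closed_subspace[OF S]])
  show "enat k \<le> genus (S \<inter> sphere1 \<mu>)"
    by (rule order_trans[OF _ dim_le_genus[OF \<mu> S]]) (use k in simp)
qed

section \<open>Upper bounds for variational eigenvalues\<close>

context connected_weighted_graph
begin

lemma rayleigh1_nonneg: "rayleigh1 w \<mu> f \<ge> 0"
  unfolding rayleigh1_def
  by (intro mult_nonneg_nonneg divide_nonneg_nonneg sum_nonneg) (auto simp: weight_nonneg vertex_weight_pos less_imp_le)

text \<open>
  In conditionally complete lattices a supremum or infimum is only meaningful for bounded sets; this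
  bound, together with \<open>rayleigh1_nonneg\<close>, justifies the minimax estimate that follows.
\<close>

lemma bdd_above_rayleigh1: "bdd_above (rayleigh1 w \<mu> ` sphere1 \<mu>)"
proof (rule bdd_aboveI2)
  fix g assume g: "g \<in> sphere1 \<mu>"
  have le: "\<bar>g $ u\<bar> \<le> 1 / \<mu> u" for u
  proof -
    have "\<mu> u * \<bar>g $ u\<bar> \<le> (\<Sum>u\<in>UNIV. \<mu> u * \<bar>g $ u\<bar>)"
      by (rule member_le_sum) (auto simp: vertex_weight_pos less_imp_le)
    then show ?thesis using g vertex_weight_pos[of u] by (simp add: sphere1_def field_simps)
  qed
  have "\<bar>g $ u - g $ v\<bar> \<le> 1 / \<mu> u + 1 / \<mu> v" for u v
    using le[of u] le[of v] by linarith
  then have "(\<Sum>u\<in>UNIV. \<Sum>v\<in>UNIV. w u v * \<bar>g $ u - g $ v\<bar>) \<le> (\<Sum>u\<in>UNIV. \<Sum>v\<in>UNIV. w u v * (1 / \<mu> u + 1 / \<mu> v))"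
    by (intro sum_mono mult_left_mono weight_nonneg)
  then show "rayleigh1 w \<mu> g \<le> 1 / 2 * (\<Sum>u\<in>UNIV. \<Sum>v\<in>UNIV. w u v * (1 / \<mu> u + 1 / \<mu> v))"
    using g by (simp add: rayleigh1_def sphere1_def)
qed

lemma variational_eigenvalue_le:
  assumes k: "1 \<le> k" and A: "A \<in> genus_family \<mu> k" and le: "\<And>g. g \<in> A \<Longrightarrow> rayleigh1 w \<mu> g \<le> l"
  shows "variational_eigenvalue w \<mu> k \<le> l"
proof -
  have ne: "B \<noteq> {}" if "B \<in> genus_family \<mu> k" for B
    using that k by (auto simp: genus_family_def genus_def zero_enat_def)
  have "0 \<le> (SUP f\<in>B. rayleigh1 w \<mu> f)" if B: "B \<in> genus_family \<mu> k" for B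
  proof -
    obtain g where "g \<in> B" using ne[OF B] by blast
    moreover have "bdd_above (rayleigh1 w \<mu> ` B)"
      using B by (intro bdd_above_mono[OF bdd_above_rayleigh1]) (auto simp: genus_family_def)
    ultimately show ?thesis using rayleigh1_nonneg by (intro cSUP_upper2)
  qed
  then have "bdd_below ((\<lambda>B. SUP f\<in>B. rayleigh1 w \<mu> f) ` genus_family \<mu> k)" by (rule bdd_belowI2)
  then have "variational_eigenvalue w \<mu> k \<le> (SUP f\<in>A. rayleigh1 w \<mu> f)"
    unfolding variational_eigenvalue_def using A by (rule cINF_lower)
  also have "\<dots> \<le> l" using ne[OF A] le by (rule cSUP_least)
  finally show ?thesis .
qed

end

definition indicator_vec :: "'v::finite set \<Rightarrow> real^'v" where
  "indicator_vec A = (\<chi> u. indicator A u)"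

lemma inj_on_indicator_vec: "inj_on indicator_vec D"
  by (rule inj_on_inverseI[where g = "\<lambda>g. {u. g $ u = 1}"])
    (auto simp: indicator_vec_def indicator_def)

lemma dim_span_indicator_vec:
  assumes ne: "{} \<notin> D" and disj: "disjoint D"
  shows "dim (span (indicator_vec ` D)) = card D"
proof -
  have "orthogonal (indicator_vec A) (indicator_vec B)" if "A \<in> D" "B \<in> D" "A \<noteq> B" for A B
  proof -
    have "A \<inter> B = {}" using disj that by (rule disjointD)
    then show ?thesis
      by (auto simp: orthogonal_def indicator_vec_def inner_vec_def indicator_def intro!: sum.neutral)
  qed
  then have "pairwise orthogonal (indicator_vec ` D)" by (auto simp: pairwise_def)
  moreover have "0 \<notin> indicator_vec ` D"
  proof
    assume "0 \<in> indicator_vec ` D"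
    then obtain A where A: "A \<in> D" "indicator_vec A = 0" by auto
    obtain u where "u \<in> A" using A ne by (cases "A = {}") auto
    then have "indicator_vec A $ u = 1" by (simp add: indicator_vec_def)
    then show False using A by simp
  qed
  ultimately have "independent (indicator_vec ` D)" by (rule pairwise_orthogonal_independent)
  then show "dim (span (indicator_vec ` D)) = card D"
    by (simp add: dim_eq_card_independent card_image[OF inj_on_indicator_vec])
qed

lemma abs_sum_indicator_disjoint:
  fixes c :: "'v::finite set \<Rightarrow> real"
  assumes disj: "disjoint D"
  shows "\<bar>\<Sum>A\<in>D. c A * indicator A u\<bar> = (\<Sum>A\<in>D. \<bar>c A\<bar> * indicator A u)"
proof (cases "\<exists>A\<in>D. u \<in> A")
  case True
  then obtain A where A: "A \<in> D" "u \<in> A" by blast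
  have "(\<Sum>B\<in>D. d B * indicator B u) = d A" for d :: "'v set \<Rightarrow> real"
  proof -
    have "u \<notin> B" if "B \<in> D - {A}" for B using disjointD[OF disj, of A B] A that by blast
    then have "(\<Sum>B\<in>D - {A}. d B * indicator B u) = 0" by (intro sum.neutral) simp
    then show ?thesis using sum.remove[of D A "\<lambda>B. d B * indicator B u"] A by simp
  qed
  then show ?thesis by simp
next
  case False
  then show ?thesis by (simp add: sum.neutral)
qed

lemma sum_UNIV_indicator:
  fixes h :: "'v::finite \<Rightarrow> real"
  shows "(\<Sum>v\<in>UNIV. h v * indicator B v) = sum h B"
  using sum_mult_indicator[of UNIV h "\<lambda>_. B" "\<lambda>v. v"] by simp

lemma (in connected_weighted_graph) total_variation_indicator:
  "(\<Sum>u\<in>UNIV. \<Sum>v\<in>UNIV. w u v * \<bar>indicator A u - indicator A v\<bar>) = 2 * boundary_weight w A"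
proof -
  let ?g = "\<lambda>u v. w u v * indicator (-A) v * indicator A u"
  have b: "(\<Sum>u\<in>UNIV. \<Sum>v\<in>UNIV. ?g u v) = boundary_weight w A"
    by (simp only: sum_distrib_right[symmetric] sum_UNIV_indicator boundary_weight_def)
  have "w u v * \<bar>indicator A u - indicator A v\<bar> = ?g u v + ?g v u" for u v
    using weight_sym[of u v] by (auto simp: indicator_def)
  then have "(\<Sum>u\<in>UNIV. \<Sum>v\<in>UNIV. w u v * \<bar>indicator A u - indicator A v\<bar>)
      = (\<Sum>u\<in>UNIV. \<Sum>v\<in>UNIV. ?g u v) + (\<Sum>u\<in>UNIV. \<Sum>v\<in>UNIV. ?g v u)"
    by (simp add: sum.distrib)
  also have "(\<Sum>u\<in>UNIV. \<Sum>v\<in>UNIV. ?g v u) = (\<Sum>u\<in>UNIV. \<Sum>v\<in>UNIV. ?g u v)" by (rule sum.swap)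
  finally show ?thesis using b by simp
qed

text \<open>
  The total variation of \<open>\<Sum> c\<^sub>A 1\<^sub>A\<close> is subadditive in the summands, while its weighted norm is
  additive because the sets \<open>A\<close> are disjoint.
\<close>

lemma (in connected_weighted_graph) rayleigh1_span_indicator_le:
  assumes ne: "{} \<notin> D" and disj: "disjoint D"
    and le: "\<And>A. A \<in> D \<Longrightarrow> boundary_weight w A \<le> l * (\<Sum>u\<in>A. \<mu> u)"
    and g: "g \<in> span (indicator_vec ` D)" "g \<in> sphere1 \<mu>"
  shows "rayleigh1 w \<mu> g \<le> l"
proof -
  obtain d where "g = (\<Sum>x\<in>indicator_vec ` D. d x *\<^sub>R x)"
    using g(1) by (auto simp: span_finite)
  then have gd: "g = (\<Sum>A\<in>D. d (indicator_vec A) *\<^sub>R indicator_vec A)"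
    by (simp add: sum.reindex[OF inj_on_indicator_vec])
  define c where "c A = d (indicator_vec A)" for A
  have gu: "g $ u = (\<Sum>A\<in>D. c A * indicator A u)" for u
    by (simp add: gd c_def indicator_vec_def)
  have "(\<Sum>u\<in>UNIV. \<Sum>v\<in>UNIV. w u v * \<bar>g $ u - g $ v\<bar>)
      \<le> (\<Sum>u\<in>UNIV. \<Sum>v\<in>UNIV. w u v * (\<Sum>A\<in>D. \<bar>c A\<bar> * \<bar>indicator A u - indicator A v\<bar>))"
  proof (intro sum_mono mult_left_mono weight_nonneg)
    fix u v
    have "\<bar>g $ u - g $ v\<bar> = \<bar>\<Sum>A\<in>D. c A * (indicator A u - indicator A v)\<bar>"
      by (simp add: gu right_diff_distrib sum_subtractf)
    also have "\<dots> \<le> (\<Sum>A\<in>D. \<bar>c A * (indicator A u - indicator A v)\<bar>)" by (rule sum_abs)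
    finally show "\<bar>g $ u - g $ v\<bar> \<le> (\<Sum>A\<in>D. \<bar>c A\<bar> * \<bar>indicator A u - indicator A v\<bar>)"
      by (simp add: abs_mult)
  qed
  also have "\<dots> = (\<Sum>u\<in>UNIV. \<Sum>v\<in>UNIV. \<Sum>A\<in>D. \<bar>c A\<bar> * (w u v * \<bar>indicator A u - indicator A v\<bar>))"
    by (simp add: sum_distrib_left algebra_simps)
  also have "\<dots> = (\<Sum>u\<in>UNIV. \<Sum>A\<in>D. \<Sum>v\<in>UNIV. \<bar>c A\<bar> * (w u v * \<bar>indicator A u - indicator A v\<bar>))"
    by (intro sum.cong refl) (rule sum.swap)
  also have "\<dots> = (\<Sum>A\<in>D. \<Sum>u\<in>UNIV. \<Sum>v\<in>UNIV. \<bar>c A\<bar> * (w u v * \<bar>indicator A u - indicator A v\<bar>))"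
    by (rule sum.swap)
  also have "\<dots> = (\<Sum>A\<in>D. \<bar>c A\<bar> * (2 * boundary_weight w A))"
    by (simp only: sum_distrib_left[symmetric] total_variation_indicator)
  also have "\<dots> \<le> (\<Sum>A\<in>D. \<bar>c A\<bar> * (2 * (l * (\<Sum>u\<in>A. \<mu> u))))"
    by (intro sum_mono mult_left_mono le) auto
  also have "\<dots> = 2 * l * (\<Sum>A\<in>D. \<bar>c A\<bar> * (\<Sum>u\<in>A. \<mu> u))"
    by (simp add: sum_distrib_left algebra_simps)
  also have "(\<Sum>A\<in>D. \<bar>c A\<bar> * (\<Sum>u\<in>A. \<mu> u)) = (\<Sum>A\<in>D. \<Sum>u\<in>UNIV. \<mu> u * (\<bar>c A\<bar> * indicator A u))"
    unfolding sum_UNIV_indicator[of \<mu>, symmetric] sum_distrib_left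
    by (intro sum.cong refl) (rule mult.left_commute)
  also have "\<dots> = (\<Sum>u\<in>UNIV. \<Sum>A\<in>D. \<mu> u * (\<bar>c A\<bar> * indicator A u))" by (rule sum.swap)
  also have "\<dots> = (\<Sum>u\<in>UNIV. \<mu> u * \<bar>g $ u\<bar>)"
    by (simp only: gu abs_sum_indicator_disjoint[OF disj] sum_distrib_left)
  also have "\<dots> = 1" using g(2) by (simp add: sphere1_def)
  finally show ?thesis using g(2) by (simp add: rayleigh1_def sphere1_def)
qed

lemma (in connected_weighted_graph) variational_eigenvalue_le_disjoint_family:
  assumes ne: "{} \<notin> D" and disj: "disjoint D"
    and le: "\<And>A. A \<in> D \<Longrightarrow> boundary_weight w A \<le> l * (\<Sum>u\<in>A. \<mu> u)"
    and k: "1 \<le> k" "k \<le> card D"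
  shows "variational_eigenvalue w \<mu> k \<le> l"
proof (rule variational_eigenvalue_le[OF k(1)])
  show "span (indicator_vec ` D) \<inter> sphere1 \<mu> \<in> genus_family \<mu> k"
    by (rule subspace_Int_sphere1_in_genus_family)
      (use k dim_span_indicator_vec[OF ne disj] vertex_weight_pos in auto)
qed (use rayleigh1_span_indicator_le[OF ne disj le] in auto)

lemma card_disjoint_le_CARD:
  fixes D :: "'v::finite set set"
  assumes "{} \<notin> D" "disjoint D"
  shows "card D \<le> CARD('v)"
  using dim_span_indicator_vec[OF assms] dim_subset_UNIV[of "span (indicator_vec ` D)"] by simp

section \<open>The nodal domain theorem\<close>

theorem theorem4p1:
  fixes E :: "'v::finite set set" and w :: "'v \<Rightarrow> 'v \<Rightarrow> real" and \<mu> :: "'v \<Rightarrow> real"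
    and f :: "real^'v" and k r :: nat
  assumes "connected_weighted_graph E w \<mu>"
    and "1 \<le> k" and "1 \<le> r" and "k + r - 1 \<le> CARD('v)"
    and "k \<noteq> 1 \<Longrightarrow> variational_eigenvalue w \<mu> (k - 1) < variational_eigenvalue w \<mu> k"
    and "\<And>j. k \<le> j \<Longrightarrow> j \<le> k + r - 1 \<Longrightarrow>
           variational_eigenvalue w \<mu> j = variational_eigenvalue w \<mu> k"
    and "k + r - 1 \<noteq> CARD('v) \<Longrightarrow>
           variational_eigenvalue w \<mu> (k + r - 1) < variational_eigenvalue w \<mu> (k + r)"
    and "eigenpair1 w \<mu> f (variational_eigenvalue w \<mu> k)"
  shows "card (strong_nodal_domains E f) \<le> k + r - 1 \<and>
         card (weak_nodal_domains E f) \<le> k + r - 1"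
proof -
  interpret connected_weighted_graph E w \<mu> by (rule assms(1))
  let ?D = "nodal_family E f"
  have ne: "{} \<notin> ?D" using nodal_family_nonempty by blast
  have disj: "disjoint ?D" by (rule disjointI) (rule nodal_family_disjoint)
  have "card ?D \<le> k + r - 1"
  proof (cases "k + r - 1 = CARD('v)")
    case True
    then show ?thesis using card_disjoint_le_CARD[OF ne disj] by simp
  next
    case False
    have "\<not> k + r \<le> card ?D"
    proof
      assume "k + r \<le> card ?D"
      then have "variational_eigenvalue w \<mu> (k + r) \<le> variational_eigenvalue w \<mu> k"
        using nodal_family_boundary_weight_le[OF assms(8)] assms(2)
        by (intro variational_eigenvalue_le_disjoint_family[OF ne disj]) auto
      moreover have "k \<le> k + r - 1" using assms(3) by simp
      ultimately show False using assms(7)[OF False] assms(6)[of "k + r - 1"] by simp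
    qed
    then show ?thesis by simp
  qed
  moreover have "card (strong_nodal_domains E f) \<le> card ?D"
    by (intro card_mono) (auto simp: nodal_family_def)
  ultimately show ?thesis using card_weak_nodal_domains_le[of E f] by linarith
qed

end
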